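(* Let $t,s$ be integers with $t>s>2$. If $\gcd(s,t)=1$, then \[ \mathrm{wsat}(s+t+1, K_{s,t})=\binom{s+t+1}{2}-(2s+2t-2). \] Otherwise (if $\gcd(s,t)>1$), \[ 2s+2t-3\le \binom{s+t+1}{2}-\mathrm{wsat}(s+t+1,K_{s,t})\le 2s+2t-2. \]
   Context: For a fixed graph $F$, an $n$-vertex graph $G$ is called weakly $F$-saturated if $G$ contains no copy of $F$ and there exists an ordering $e_1,\dots,e_m$ of the edges of $E(K_n)\setminus E(G)$ such that for each $i\in\{1,\dots,m\}$ the graph $G\cup\{e_1,\dots,e_i\}$ contains a copy $F_i$ of $F$ with $e_i\in E(F_i)$. The weak saturation number $\mathrm{wsat}(n,F)$ is the minimum number of edges of a weakly $F$-saturated $n$-vertex graph. $K_{s,t}$ denotes the complete bipartite graph with parts of sizes $s$ and $t$. *)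

theory Defs
  imports Complex_Main "HOL-Library.Ramsey"
begin

text \<open>A graph is a pair of a vertex set and a set of undirected edges, each edge being
  a two-element set of vertices; \<open>[V]\<^bsup>2\<^esup>\<close> (from Ramsey) is the edge set of the
  complete graph on \<open>V\<close>.\<close>

type_synonym 'a graph = "'a set \<times> 'a set set"

abbreviation verts :: "'a graph \<Rightarrow> 'a set" where
  "verts G \<equiv> fst G"

abbreviation edges :: "'a graph \<Rightarrow> 'a set set" where
  "edges G \<equiv> snd G"

definition finite_simple_graph :: "'a graph \<Rightarrow> bool" where
  "finite_simple_graph G \<longleftrightarrow> finite (verts G) \<and> edges G \<subseteq> [verts G]\<^bsup>2\<^esup>"

definition add_edges :: "'a graph \<Rightarrow> 'a set set \<Rightarrow> 'a graph" where
  "add_edges G S = (verts G, edges G \<union> S)"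

definition subgraph :: "'a graph \<Rightarrow> 'a graph \<Rightarrow> bool" where
  "subgraph H G \<longleftrightarrow> verts H \<subseteq> verts G \<and> edges H \<subseteq> edges G"

definition isomorphic :: "'a graph \<Rightarrow> 'b graph \<Rightarrow> bool" where
  "isomorphic F H \<longleftrightarrow> (\<exists>f. bij_betw f (verts F) (verts H) \<and> edges H = (\<lambda>e. f ` e) ` edges F)"

text \<open>Copies need not be induced subgraphs.\<close>

definition copy_in :: "'b graph \<Rightarrow> 'a graph \<Rightarrow> 'a graph \<Rightarrow> bool" where
  "copy_in F G H \<longleftrightarrow> subgraph H G \<and> isomorphic F H"

text \<open>The list \<open>es\<close> is the ordering \<open>e\<^sub>1, \<dots>, e\<^sub>m\<close>, indexed from \<open>0\<close>.\<close>

definition weakly_saturated :: "'b graph \<Rightarrow> 'a graph \<Rightarrow> bool" where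
  "weakly_saturated F G \<longleftrightarrow>
     (\<nexists>H. copy_in F G H) \<and>
     (\<exists>es. distinct es \<and> set es = [verts G]\<^bsup>2\<^esup> - edges G \<and>
        (\<forall>i < length es.
           \<exists>H. copy_in F (add_edges G (set (take (Suc i) es))) H \<and> es ! i \<in> edges H))"

text \<open>If \<open>F\<close> is a finite simple graph with at least one edge, then a weakly
  \<open>F\<close>-saturated graph on \<open>n\<close> vertices exists (any edge-maximal \<open>F\<close>-free graph is one),
  so the minimum is attained. Taking vertices in \<open>nat\<close> loses no generality.\<close>

definition wsat :: "nat \<Rightarrow> 'b graph \<Rightarrow> nat" where
  "wsat n F = (LEAST m. \<exists>G :: nat graph. finite_simple_graph G \<and> card (verts G) = n \<and>
                 weakly_saturated F G \<and> card (edges G) = m)"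

definition complete_bipartite :: "nat \<Rightarrow> nat \<Rightarrow> (nat + nat) graph" where
  "complete_bipartite s t = ({..<s} <+> {..<t}, {{Inl i, Inr j} | i j. i < s \<and> j < t})"

end

(*
  Let n = s + t + 1 and let M be the set of missing edges. Filling in an edge e of M is possible iff
  some vertex w can be deleted and the others split into parts of sizes s and t such that e is the
  only edge of M across the split. Hence (n choose 2) - wsat is the largest size of an M that can be
  filled in completely, and the claim is that this size is 2n - 4, or possibly 2n - 5 if s and t are
  not coprime.

  Upper bound. Inserting a crossing edge preserves the Laman type condition |M[T]| <= 2|T| - 3, and T
  can reach equality ("T is tight") only if T is a single edge, or w lies in T and both sides of T
  together with w were tight before. If V itself is tight, removing edges thus splits V into tight
  sets glued along single vertices; the requirement that one side has exactly s vertices restricts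
  the possible gluings so much that the empty set of edges is never reached.

  Lower bound. Take vertices c, u and sets Q1, Q2, B of sizes s - 1, k, t - k, join c to everything
  outside B, join u to everything outside Q1 except one vertex z of B, span Q1 by a star with centre
  q, and add the edge uq.
  With w = u the set B can then be spanned by a tree, using splits of B into s and t - k - s vertices;
  this works by Euclid's algorithm if s and t - k - s are coprime. Take k = 0 if s and t are coprime,
  in which case also qz fits in, and k = t - s - 1 otherwise.
*)
theory Submission
  imports Defs "HOL-Library.Disjoint_Sets"
begin

section \<open>Edge sets that can be filled in one by one\<close>

definition splits :: "'a set \<Rightarrow> nat \<Rightarrow> nat \<Rightarrow> ('a set \<times> 'a set) set" where
  "splits V s t = {(X, Y). X \<union> Y \<subseteq> V \<and> X \<inter> Y = {} \<and> card X = s \<and> card Y = t}"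

text \<open>\<open>M\<close> is a set of missing edges that can be filled in one after the other. The edge inserted by
  the outermost rule application is filled in first, so the induction runs backwards in time.\<close>

inductive fillable :: "('a set \<times> 'a set) set \<Rightarrow> 'a set set \<Rightarrow> bool" for P where
  fillable_empty: "fillable P {}"
| fillable_insert: "fillable P M \<Longrightarrow> (X, Y) \<in> P \<Longrightarrow> \<forall>x\<in>X. \<forall>y\<in>Y. {x, y} \<notin> M \<Longrightarrow> x \<in> X \<Longrightarrow> y \<in> Y
    \<Longrightarrow> fillable P (insert {x, y} M)"

lemma fillable_splits_subset:
  assumes "fillable (splits V s t) M"
  shows "M \<subseteq> [V]\<^bsup>2\<^esup>"
  using assms
proof (induction rule: fillable.induct)
  case (fillable_insert M X Y x y)
  then have "x \<noteq> y" "x \<in> V" "y \<in> V" by (auto simp: splits_def)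
  then have "{x, y} \<in> [V]\<^bsup>2\<^esup>" by (auto simp: nsets_def)
  then show ?case using fillable_insert by auto
qed auto

section \<open>Sparsity and tight vertex sets\<close>

definition induced :: "'a set set \<Rightarrow> 'a set \<Rightarrow> 'a set set" where
  "induced M T = {e \<in> M. e \<subseteq> T}"

text \<open>The (2,3)-sparsity known from Laman graphs; the 3 stands on the left to avoid truncated
  subtraction on \<open>nat\<close>.\<close>

definition sparse :: "'a set \<Rightarrow> 'a set set \<Rightarrow> bool" where
  "sparse V M \<longleftrightarrow> (\<forall>T \<subseteq> V. 2 \<le> card T \<longrightarrow> card (induced M T) + 3 \<le> 2 * card T)"

definition tight :: "'a set set \<Rightarrow> 'a set \<Rightarrow> bool" where
  "tight M T \<longleftrightarrow> 2 \<le> card T \<and> card (induced M T) + 3 = 2 * card T"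

lemma tight_insert_outside:
  assumes "tight (insert e M) T" "\<not> e \<subseteq> T"
  shows "tight M T"
proof -
  have "induced (insert e M) T = induced M T" using assms by (auto simp: induced_def)
  then show ?thesis using assms by (simp add: tight_def)
qed

text \<open>Parity: with no induced edge, 3 would have to be even.\<close>

lemma tight_nonempty: "tight M T \<Longrightarrow> induced M T \<noteq> {}"
  unfolding tight_def by (metis add_0 card.empty dvd_triv_left odd_numeral)

text \<open>One application of \<open>fillable_insert\<close> for \<open>card V = s + t + 1\<close>:
  \<open>M\<close> is the set before the edge \<open>{a, b}\<close> is inserted, and
  \<open>w\<close> is the single vertex that the split leaves out. The vertex \<open>w\<close> may
  change from step to step. The sizes of \<open>X\<close> and \<open>Y\<close> enter only where the
  shape of a decomposition matters.\<close>

locale edge_step =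
  fixes V X Y :: "'a set" and w a b :: 'a and M :: "'a set set"
  assumes fin: "finite V" and V: "V = insert w (X \<union> Y)" and XY: "X \<inter> Y = {}"
    and wX: "w \<notin> X" and wY: "w \<notin> Y" and a: "a \<in> X" and b: "b \<in> Y"
    and cross: "\<And>x y. x \<in> X \<Longrightarrow> y \<in> Y \<Longrightarrow> {x, y} \<notin> M"
    and M: "M \<subseteq> [V]\<^bsup>2\<^esup>" and sparse: "sparse V M"
begin

lemma finX: "finite X" and finY: "finite Y" and finM: "finite M"
  using fin V M by (auto intro: finite_subset finite_imp_finite_nsets)

lemma ab: "a \<noteq> b" "a \<noteq> w" "b \<noteq> w" "a \<notin> Y" "b \<notin> X" "{a, b} \<notin> M"
  using a b XY wX wY cross by auto

lemma edge_side:
  assumes "e \<in> M" shows "e \<inter> X = {} \<or> e \<inter> Y = {}"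
proof (rule ccontr)
  assume "\<not> ?thesis"
  then obtain x y where xy: "x \<in> e" "x \<in> X" "y \<in> e" "y \<in> Y" by auto
  then have "x \<noteq> y" using XY by auto
  have "card e = 2" "finite e" using M assms by (auto simp: nsets_def)
  then have "e = {x, y}" using xy \<open>x \<noteq> y\<close> by (metis card_2_iff doubleton_eq_iff insert_iff singletonD)
  then show False using cross xy assms by auto
qed

text \<open>No edge of \<open>M\<close> meets both \<open>X\<close> and \<open>Y\<close>, so each
  edge inside \<open>T\<close> lies in \<open>T - Y\<close> or in \<open>T - X\<close>. It cannot
  lie in both, since these sets share at most \<open>w\<close>.\<close>

lemma card_induced_split:
  assumes "T \<subseteq> V"
  shows "card (induced M T) = card (induced M (T - Y)) + card (induced M (T - X))"
proof -
  have 1: "induced M T = induced M (T - Y) \<union> induced M (T - X)"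
    using edge_side by (auto simp: induced_def)
  have "e \<notin> induced M (T - X)" if "e \<in> induced M (T - Y)" for e
  proof
    assume "e \<in> induced M (T - X)"
    then have "e \<subseteq> {w}" "e \<in> M" using that assms V by (auto simp: induced_def)
    then have "card e \<le> 1" using card_mono[of "{w}" e] by auto
    then show False using \<open>e \<in> M\<close> M by (auto simp: nsets_def)
  qed
  then have "induced M (T - Y) \<inter> induced M (T - X) = {}" by auto
  moreover have "finite (induced M S)" for S using finM by (auto simp: induced_def)
  ultimately show ?thesis unfolding 1 by (intro card_Un_disjoint) auto
qed

text \<open>The correction term covers singletons, which carry no edge although
  \<open>2 * card T - 3\<close> would be -1.\<close>

lemma card_induced_le:
  assumes "T \<subseteq> V" "T \<noteq> {}" shows "card (induced M T) + 3 \<le> 2 * card T + (if card T = 1 then 1 else 0)"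
proof (cases "card T \<ge> 2")
  case True then show ?thesis using sparse assms by (auto simp: sparse_def)
next
  case False
  have "finite T" using assms fin finite_subset by auto
  then have c: "card T = 1" using False assms by (metis One_nat_def card_0_eq less_2_cases not_le)
  have "e \<notin> induced M T" for e
  proof
    assume "e \<in> induced M T"
    then have "card e \<le> 1" "card e = 2" using c card_mono[OF \<open>finite T\<close>, of e] M by (auto simp: induced_def nsets_def)
    then show False by simp
  qed
  then have "induced M T = {}" by auto
  then show ?thesis using c by simp
qed

lemma card_parts:
  assumes "T \<subseteq> V"
  shows "card T = card (T \<inter> X) + card (T \<inter> Y) + (if w \<in> T then 1 else 0)"
    "card (T - Y) = card (T \<inter> X) + (if w \<in> T then 1 else 0)"
    "card (T - X) = card (T \<inter> Y) + (if w \<in> T then 1 else 0)"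
proof -
  have 1: "T - Y = (if w \<in> T then insert w (T \<inter> X) else T \<inter> X)"
    and 2: "T - X = (if w \<in> T then insert w (T \<inter> Y) else T \<inter> Y)"
    using assms V XY wX wY by auto
  have T: "T = (T - Y) \<union> (T \<inter> Y)" by auto
  have f: "finite T" using assms fin finite_subset by auto
  show "card (T - Y) = card (T \<inter> X) + (if w \<in> T then 1 else 0)"
    "card (T - X) = card (T \<inter> Y) + (if w \<in> T then 1 else 0)"
    unfolding 1 2 using f wX wY by auto
  moreover have "card T = card (T - Y) + card (T \<inter> Y)"
    by (subst T, rule card_Un_disjoint) (use f in auto)
  ultimately show "card T = card (T \<inter> X) + card (T \<inter> Y) + (if w \<in> T then 1 else 0)" by simp
qed

text \<open>Add the bounds for \<open>T - Y\<close> and \<open>T - X\<close>. If \<open>w\<close> is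
  in \<open>T\<close>, it is counted twice, both parts have at least two vertices, and the sum is
  \<open>2 * (card T + 1) - 6\<close>; equality forces equality in both parts. If \<open>w\<close>
  is not in \<open>T\<close>, the sum is \<open>2 * card T - 6\<close> plus 1 for each singleton
  part, so only \<open>card T = 2\<close> reaches \<open>2 * card T - 4\<close>.\<close>

lemma induced_bound:
  assumes "T \<subseteq> V" "T \<inter> X \<noteq> {}" "T \<inter> Y \<noteq> {}"
  shows "card (induced M T) + 4 \<le> 2 * card T"
    "w \<notin> T \<Longrightarrow> card T \<noteq> 2 \<Longrightarrow> card (induced M T) + 5 \<le> 2 * card T"
    "w \<in> T \<Longrightarrow> card (induced M T) + 4 = 2 * card T \<Longrightarrow> tight M (T - Y) \<and> tight M (T - X)"
proof -
  note s = card_induced_split[OF assms(1)] and p = card_parts[OF assms(1)]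
  have ne: "T - Y \<noteq> {}" "T - X \<noteq> {}" using assms XY by auto
  have sub: "T - Y \<subseteq> V" "T - X \<subseteq> V" using assms by auto
  note l = card_induced_le[OF sub(1) ne(1)] card_induced_le[OF sub(2) ne(2)]
  have c: "card (T \<inter> X) > 0" "card (T \<inter> Y) > 0" using assms finX finY by (auto simp: card_gt_0_iff)
  show "card (induced M T) + 4 \<le> 2 * card T" using s p l c by (auto split: if_splits)
  show "w \<notin> T \<Longrightarrow> card T \<noteq> 2 \<Longrightarrow> card (induced M T) + 5 \<le> 2 * card T"
    using s p l c by (auto split: if_splits)
  assume "w \<in> T" "card (induced M T) + 4 = 2 * card T"
  then show "tight M (T - Y) \<and> tight M (T - X)"
    using s p l c by (auto simp: tight_def split: if_splits)
qed

text \<open>A set containing the new edge meets both sides, so it had one edge to spare.\<close>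

lemma sparse_insert: "sparse V (insert {a, b} M)"
  unfolding sparse_def
proof (intro allI impI)
  fix T assume T: "T \<subseteq> V" "2 \<le> card T"
  show "card (induced (insert {a, b} M) T) + 3 \<le> 2 * card T"
  proof (cases "{a, b} \<subseteq> T")
    case True
    then have "induced (insert {a, b} M) T = insert {a, b} (induced M T)" by (auto simp: induced_def)
    then have "card (induced (insert {a, b} M) T) \<le> card (induced M T) + 1" by (simp add: card_insert_le_m1)
    moreover have "T \<inter> X \<noteq> {}" "T \<inter> Y \<noteq> {}" using True a b by auto
    ultimately show ?thesis using induced_bound(1)[OF T(1)] by simp
  next
    case False
    then have "induced (insert {a, b} M) T = induced M T" by (auto simp: induced_def)
    then show ?thesis using T sparse by (auto simp: sparse_def)
  qed
qed

text \<open>Such a set was tight already before the insertion, whereas a set meeting both sides is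
  not tight in \<open>M\<close>.\<close>

lemma tight_side:
  assumes "tight (insert {a, b} M) T" "T \<subseteq> V" "\<not> {a, b} \<subseteq> T"
  shows "T \<inter> X = {} \<or> T \<inter> Y = {}"
  using tight_insert_outside[OF assms(1,3)] induced_bound(1)[OF assms(2)] by (auto simp: tight_def)

text \<open>This is the equality case of \<open>induced_bound\<close>: a tight set through the new
  edge is the edge alone or two tight sets glued at \<open>w\<close>.\<close>

lemma tight_split:
  assumes "tight (insert {a, b} M) T" "T \<subseteq> V" "{a, b} \<subseteq> T"
  shows "T = {a, b} \<and> w \<notin> T \<or> w \<in> T \<and> tight M (T - Y) \<and> tight M (T - X)"
proof -
  have "induced (insert {a, b} M) T = insert {a, b} (induced M T)" using assms by (auto simp: induced_def)
  moreover have "finite (induced M T)" "{a, b} \<notin> induced M T" using finM ab by (auto simp: induced_def)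
  ultimately have c: "card (induced M T) + 4 = 2 * card T" using assms by (simp add: tight_def)
  have ne: "T \<inter> X \<noteq> {}" "T \<inter> Y \<noteq> {}" using assms a b by auto
  show ?thesis
  proof (cases "w \<in> T")
    case True then show ?thesis using induced_bound(3)[OF assms(2) ne] c by simp
  next
    case False
    then have "card T = 2" using induced_bound(2)[OF assms(2) ne] c by fastforce
    then have "T = {a, b}" using assms(3) ab(1)
      by (metis card.empty card_2_iff doubleton_eq_iff insert_subset insert_iff singletonD)
    then show ?thesis using False by simp
  qed
qed

end

lemma fillable_splits_edge_step:
  assumes "finite V" "card V = s + t + 1" "(X, Y) \<in> splits V s t"
    "\<forall>x\<in>X. \<forall>y\<in>Y. {x, y} \<notin> M" "x \<in> X" "y \<in> Y" "M \<subseteq> [V]\<^bsup>2\<^esup>" "sparse V M"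
  obtains w where "edge_step V X Y w x y M"
proof -
  have XY: "X \<subseteq> V" "Y \<subseteq> V" "X \<inter> Y = {}" "card X = s" "card Y = t" using assms by (auto simp: splits_def)
  have "card (X \<union> Y) = s + t"
    using XY assms(1) by (metis card_Un_disjoint finite_subset)
  then have "card (V - (X \<union> Y)) = 1"
    using XY assms(1,2) by (subst card_Diff_subset) (auto intro: finite_subset)
  then obtain w where "V - (X \<union> Y) = {w}" by (auto simp: card_1_singleton_iff)
  then have "V = insert w (X \<union> Y)" "w \<notin> X" "w \<notin> Y" using XY by auto
  then have "edge_step V X Y w x y M" using assms XY by unfold_locales auto
  then show ?thesis by (rule that)
qed

lemma fillable_sparse:
  assumes "fillable (splits V s t) M" "finite V" "card V = s + t + 1"
  shows "sparse V M"
  using assms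
proof (induction rule: fillable.induct)
  case fillable_empty
  show ?case by (auto simp: sparse_def induced_def)
next
  case (fillable_insert M X Y x y)
  then obtain w where "edge_step V X Y w x y M"
    using fillable_splits_edge_step fillable_splits_subset by metis
  then show ?case by (rule edge_step.sparse_insert)
qed

section \<open>Backward decomposition when all of \<open>V\<close> is tight\<close>

lemma card_le_minus_one:
  assumes "X \<subseteq> S - {x, y}" "finite S" "x \<in> S" "y \<in> S" "x \<noteq> y"
  shows "card X + 2 \<le> card S"
proof -
  have "card X \<le> card (S - {x, y})" using assms by (intro card_mono) auto
  also have "card (S - {x, y}) = card S - 2" using assms by (subst card_Diff_subset) auto
  finally have "card X \<le> card S - 2" .
  moreover have "card {x, y} \<le> card S" using assms by (intro card_mono) auto
  ultimately show ?thesis using assms by auto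
qed

text \<open>The three shapes in which a tight \<open>V\<close> decomposes backwards in time: blocks of size \<open>s\<close> hanging on a
  tight root \<open>R\<close>; then small blocks sharing one vertex \<open>u\<close>, if a block is hit, or, if \<open>R\<close> has
  shrunk to a single edge and this edge is removed, two disconnected parts, in which no step is possible.\<close>

definition rooted_config :: "'a set \<Rightarrow> nat \<Rightarrow> 'a set set \<Rightarrow> bool" where
  "rooted_config V s M \<longleftrightarrow> (\<exists>R \<D> f. R \<union> \<Union>\<D> = V \<and> R \<inter> \<Union>\<D> = {} \<and> disjoint \<D> \<and> tight M R \<and>
     (\<forall>D\<in>\<D>. card D = s \<and> f D \<in> R \<and> tight M (insert (f D) D)) \<and>
     (\<forall>e\<in>M. e \<subseteq> R \<or> (\<exists>D\<in>\<D>. e \<subseteq> insert (f D) D)))"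

definition star_config :: "'a set \<Rightarrow> nat \<Rightarrow> 'a set set \<Rightarrow> bool" where
  "star_config V s M \<longleftrightarrow> (\<exists>u \<D>. insert u (\<Union>\<D>) = V \<and> u \<notin> \<Union>\<D> \<and> disjoint \<D> \<and>
     (\<forall>D\<in>\<D>. card D \<le> s \<and> tight M (insert u D)) \<and> (\<forall>e\<in>M. \<exists>D\<in>\<D>. e \<subseteq> insert u D))"

definition stuck_config :: "'a set \<Rightarrow> nat \<Rightarrow> 'a set set \<Rightarrow> bool" where
  "stuck_config V s M \<longleftrightarrow> (\<exists>K y \<D>. K \<union> insert y (\<Union>\<D>) = V \<and> K \<inter> insert y (\<Union>\<D>) = {} \<and> y \<notin> \<Union>\<D> \<and>
     disjoint \<D> \<and> card K = s + 1 \<and> tight M K \<and>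
     (\<forall>D\<in>\<D>. card D = s \<and> tight M (insert y D)) \<and>
     (\<forall>e\<in>M. e \<subseteq> K \<or> (\<exists>D\<in>\<D>. e \<subseteq> insert y D)))"

lemma rooted_configI:
  assumes "R \<union> \<Union>\<D> = V" "R \<inter> \<Union>\<D> = {}" "disjoint \<D>" "tight M R"
    "\<And>D. D \<in> \<D> \<Longrightarrow> card D = s \<and> f D \<in> R \<and> tight M (insert (f D) D)"
    "\<And>e. e \<in> M \<Longrightarrow> e \<subseteq> R \<or> (\<exists>D\<in>\<D>. e \<subseteq> insert (f D) D)"
  shows "rooted_config V s M"
  unfolding rooted_config_def
  by (rule exI[of _ R], rule exI[of _ \<D>], rule exI[of _ f]) (intro conjI ballI assms(1-4); use assms(5,6) in blast)

lemma star_configI: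
  assumes "insert u (\<Union>\<D>) = V" "u \<notin> \<Union>\<D>" "disjoint \<D>"
    "\<And>D. D \<in> \<D> \<Longrightarrow> card D \<le> s \<and> tight M (insert u D)"
    "\<And>e. e \<in> M \<Longrightarrow> \<exists>D\<in>\<D>. e \<subseteq> insert u D"
  shows "star_config V s M"
  unfolding star_config_def
  by (rule exI[of _ u], rule exI[of _ \<D>]) (intro conjI ballI assms(1-3); use assms(4,5) in blast)

lemma stuck_configI:
  assumes "K \<union> insert y (\<Union>\<D>) = V" "K \<inter> insert y (\<Union>\<D>) = {}" "y \<notin> \<Union>\<D>"
    "disjoint \<D>" "card K = s + 1" "tight M K"
    "\<And>D. D \<in> \<D> \<Longrightarrow> card D = s \<and> tight M (insert y D)"
    "\<And>e. e \<in> M \<Longrightarrow> e \<subseteq> K \<or> (\<exists>D\<in>\<D>. e \<subseteq> insert y D)"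
  shows "stuck_config V s M"
  unfolding stuck_config_def
  by (rule exI[of _ K], rule exI[of _ y], rule exI[of _ \<D>]) (intro conjI ballI assms(1-6); use assms(7,8) in blast)

context edge_step
begin

text \<open>Whichever block contains the new edge has \<open>s + 1\<close> vertices, among them
  \<open>w\<close>. Tightness keeps each remaining block on one side, so that some whole side has to
  fit into this block without \<open>w\<close> and one end of the edge, which leaves only
  \<open>s - 1\<close> places.\<close>

lemma no_stuck_config:
  assumes "card X = s" "card Y = t" "2 < s" "s < t"
  shows "\<not> stuck_config V s (insert {a, b} M)"
proof
  assume "stuck_config V s (insert {a, b} M)"
  then obtain K y \<D> where C0: "K \<union> insert y (\<Union>\<D>) = V" "K \<inter> insert y (\<Union>\<D>) = {}" "y \<notin> \<Union>\<D>"
     "disjoint \<D>" "card K = s + 1" "tight (insert {a, b} M) K"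
     "\<forall>D\<in>\<D>. card D = s \<and> tight (insert {a, b} M) (insert y D)"
     "\<forall>e\<in>insert {a, b} M. e \<subseteq> K \<or> (\<exists>D\<in>\<D>. e \<subseteq> insert y D)"
    unfolding stuck_config_def by (elim exE conjE) (rule that)
  note C = C0(1-6) C0(7)[rule_format, THEN conjunct1] C0(7)[rule_format, THEN conjunct2]
    C0(8)[rule_format, OF insertI1]
  have KV: "K \<subseteq> V" and DV: "\<And>D. D \<in> \<D> \<Longrightarrow> insert y D \<subseteq> V" using C(1) by auto
  have finK: "finite K" using KV fin finite_subset by auto
  have finD: "finite D" if "D \<in> \<D>" for D using DV[OF that] fin by (meson finite_insert finite_subset)
  have ab2: "card {a, b} = 2" using ab by simp
  from C(9) show False
  proof
    assume abK: "{a, b} \<subseteq> K"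
    then have wK: "w \<in> K" using tight_split[OF C(6) KV] C(5) ab2 assms(3) by auto
    \<comment> \<open>All these blocks share \<open>y\<close>, so they all lie on the side of
      \<open>y\<close>, and the opposite side is contained in \<open>K\<close>.\<close>
    have side: "insert y D \<inter> X = {} \<or> insert y D \<inter> Y = {}" if "D \<in> \<D>" for D
      using tight_side[OF C(8)[OF that] DV[OF that]] abK C(2) that by blast
    have yXY: "y \<in> X \<or> y \<in> Y" using C(1,2) V wK by auto
    have "X \<subseteq> K - {w, b} \<or> Y \<subseteq> K - {w, a}"
    proof (cases "y \<in> X")
      case True
      then have "D \<inter> Y = {}" if "D \<in> \<D>" for D using side[OF that] by auto
      moreover have "Y \<subseteq> K \<union> insert y (\<Union>\<D>)" using C(1) V by auto
      ultimately have "Y \<subseteq> K" using True XY by blast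
      then show ?thesis using wY ab by auto
    next
      case False
      then have "y \<in> Y" using yXY by auto
      then have "D \<inter> X = {}" if "D \<in> \<D>" for D using side[OF that] by auto
      moreover have "X \<subseteq> K \<union> insert y (\<Union>\<D>)" using C(1) V by auto
      ultimately have "X \<subseteq> K" using False by blast
      then show ?thesis using wX ab by auto
    qed
    then have "card X + 2 \<le> card K \<or> card Y + 2 \<le> card K"
      using card_le_minus_one[of X K w b] card_le_minus_one[of Y K w a] finK wK abK ab by auto
    then show False using C(5) assms by auto
  next
    assume "\<exists>D\<in>\<D>. {a, b} \<subseteq> insert y D"
    then obtain D where D: "D \<in> \<D>" and abD: "{a, b} \<subseteq> insert y D" by auto
    have yD: "y \<notin> D" using C(3) D by auto
    have cD: "card (insert y D) = s + 1" using C(7)[OF D] finD[OF D] yD by simp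
    have "card (insert y D) \<noteq> card {a, b}" unfolding cD ab2 using assms by simp
    then have "insert y D \<noteq> {a, b}" by metis
    then have wD: "w \<in> insert y D" using tight_split[OF C(8)[OF D] DV[OF D] abD] by blast
    have "a \<notin> K" using abD C(2) D by auto
    then have "K \<inter> X = {} \<or> K \<inter> Y = {}" using tight_side[OF C(6) KV] by auto
    moreover have "\<not> K \<subseteq> X" using card_mono[OF finX, of K] C(5) assms by auto
    moreover have "w \<notin> K" using wD C(2) D by auto
    ultimately have KX: "K \<inter> X = {}" using KV V by auto
    \<comment> \<open>A block meeting \<open>X\<close> would lie in \<open>X\<close> and equal it by
      cardinality, but \<open>a\<close> is in \<open>X\<close> and outside \<open>E\<close>.\<close>
    have DX: "E \<inter> X = {}" if "E \<in> \<D>" "E \<noteq> D" for E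
    proof (rule ccontr)
      assume ne: "E \<inter> X \<noteq> {}"
      have ED: "E \<inter> D = {}" using C(4) that D by (meson disjointD)
      have "y \<notin> E" using C(3) that by auto
      have "\<not> {a, b} \<subseteq> insert y E" using abD ED ab \<open>y \<notin> E\<close> yD by auto
      then have "E \<inter> Y = {}" using tight_side[OF C(8)[OF that(1)] DV[OF that(1)]] ne by auto
      moreover have "w \<notin> E" using wD ED \<open>y \<notin> E\<close> by auto
      ultimately have "E \<subseteq> X" using DV[OF that(1)] V by auto
      then have "E = X" using card_subset_eq[OF finX] C(7)[OF that(1)] assms by auto
      then have "a \<in> E" using a by auto
      then show False using abD ED \<open>y \<notin> E\<close> by auto
    qed
    have "X \<subseteq> insert y D"
    proof
      fix x assume x: "x \<in> X"
      then have "x \<in> V" using V by auto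
      then show "x \<in> insert y D" using x KX DX C(1) by blast
    qed
    then have "X \<subseteq> insert y D - {w, b}" using wX ab by auto
    then have "card X + 2 \<le> card (insert y D)"
      by (rule card_le_minus_one) (use finD[OF D] wD abD ab in auto)
    then show False using cD assms by auto
  qed
qed

text \<open>The point is that \<open>w\<close> must be the centre \<open>u\<close>. Then the block
  \<open>D\<close> with the new edge falls into the two blocks \<open>D \<inter> X\<close> and
  \<open>D \<inter> Y\<close>, and the other blocks stay tight.\<close>

lemma star_config_back:
  assumes "card X = s" "card Y = t" "2 < s" "s < t" "star_config V s (insert {a, b} M)"
  shows "star_config V s M"
proof -
  obtain u \<D> where C0: "insert u (\<Union>\<D>) = V" "u \<notin> \<Union>\<D>" "disjoint \<D>"
     "\<forall>D\<in>\<D>. card D \<le> s \<and> tight (insert {a, b} M) (insert u D)"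
     "\<forall>e\<in>insert {a, b} M. \<exists>D\<in>\<D>. e \<subseteq> insert u D"
    using assms(5) unfolding star_config_def by (elim exE conjE) (rule that)
  note C = C0(1-3) C0(4)[rule_format, THEN conjunct1] C0(4)[rule_format, THEN conjunct2]
    C0(5)[rule_format]
  obtain D where D: "D \<in> \<D>" and abD: "{a, b} \<subseteq> insert u D" using C(6)[of "{a, b}"] by auto
  have DV: "insert u E \<subseteq> V" if "E \<in> \<D>" for E using C(1) that by auto
  have finD: "finite D" using DV[OF D] fin by (meson finite_insert finite_subset)
  have uD: "u \<notin> D" using C(2) D by auto
  have other: "E \<inter> D = {}" "u \<notin> E" "\<not> {a, b} \<subseteq> insert u E" if "E \<in> \<D>" "E \<noteq> D" for E
  proof -
    show 1: "E \<inter> D = {}" using C(3) that D by (meson disjointD)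
    show 2: "u \<notin> E" using C(2) that by auto
    show "\<not> {a, b} \<subseteq> insert u E" using abD 1 ab 2 uD by auto
  qed
  have side: "insert u E \<inter> X = {} \<or> insert u E \<inter> Y = {}" if "E \<in> \<D>" "E \<noteq> D" for E
    using tight_side[OF C(5) DV] other that by auto
  have cs: "insert u D = {a, b} \<and> w \<notin> insert u D \<or>
      w \<in> insert u D \<and> tight M (insert u D - Y) \<and> tight M (insert u D - X)"
    using tight_split[OF C(5)[OF D] DV[OF D] abD] .
  have wu: "w = u"
  proof (rule ccontr)
    assume "w \<noteq> u"
    then have "u \<in> X \<or> u \<in> Y" using C(1) V by auto
    then have "X \<subseteq> insert u D - {u} \<or> Y \<subseteq> insert u D - {u}"
    proof
      assume u: "u \<in> X"
      then have "E \<inter> Y = {}" if "E \<in> \<D>" "E \<noteq> D" for E using side[OF that] by auto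
      then have "Y \<subseteq> insert u D" using C(1) V by fastforce
      then show ?thesis using u XY by auto
    next
      assume u: "u \<in> Y"
      then have "E \<inter> X = {}" if "E \<in> \<D>" "E \<noteq> D" for E using side[OF that] by auto
      then have "X \<subseteq> insert u D" using C(1) V by fastforce
      then show ?thesis using u XY by auto
    qed
    then have XYD: "X \<subseteq> D \<or> Y \<subseteq> D" by auto
    show False
    proof (cases "w \<in> insert u D")
      case True
      then have "w \<in> D" using \<open>w \<noteq> u\<close> by auto
      then have "card (D - {w}) < s" using C(4)[OF D] finD
        by (metis card_Diff1_less order_less_le_trans)
      moreover have "X \<subseteq> D - {w} \<or> Y \<subseteq> D - {w}" using XYD wX wY by auto
      ultimately show False using card_mono[of "D - {w}"] finD assms
        by (metis finite_Diff leD order_less_trans)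
    next
      case False
      then have "D \<subseteq> {a, b}" using cs by auto
      then have "card D \<le> 2" using card_mono[of "{a, b}" D] ab by auto
      then have "card X \<le> 2 \<or> card Y \<le> 2" using XYD card_mono[OF finD] le_trans by blast
      then show False using assms by auto
    qed
  qed
  then have t: "tight M (insert u D - Y)" "tight M (insert u D - X)" using cs by auto
  have eq: "insert u D - Y = insert u (D \<inter> X)" "insert u D - X = insert u (D \<inter> Y)"
    using wu wX wY DV[OF D] V XY uD by auto
  let ?\<D> = "insert (D \<inter> X) (insert (D \<inter> Y) (\<D> - {D}))"
  have "D = D \<inter> X \<union> D \<inter> Y" using wu uD DV[OF D] V by auto
  then have U: "\<Union>?\<D> = \<Union>\<D>" using D by blast
  then have "insert u (\<Union>?\<D>) = V" "u \<notin> \<Union>?\<D>" using C(1,2) by auto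
  moreover have "disjoint ?\<D>" using C(3) other XY D
    by (auto simp: disjoint_def pairwise_insert disjnt_def pairwise_def)
  moreover have "card E \<le> s \<and> tight M (insert u E)" if "E \<in> ?\<D>" for E
  proof (cases "E = D \<inter> X \<or> E = D \<inter> Y")
    case True
    then have "card E \<le> card D" using finD by (auto intro: card_mono)
    then show ?thesis using True t C(4)[OF D] unfolding eq by auto
  next
    case False
    then have E: "E \<in> \<D>" "E \<noteq> D" using that by auto
    then show ?thesis using C(4)[OF E(1)] tight_insert_outside[OF C(5)[OF E(1)] other(3)[OF E]] by auto
  qed
  moreover have "\<exists>E\<in>?\<D>. e \<subseteq> insert u E" if "e \<in> M" for e
  proof -
    obtain E where E: "E \<in> \<D>" "e \<subseteq> insert u E" using C(6)[of e] \<open>e \<in> M\<close> by auto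
    show ?thesis
    proof (cases "E = D")
      case True
      then have "e \<subseteq> insert u D - X \<or> e \<subseteq> insert u D - Y" using edge_side[OF that] E by auto
      then show ?thesis unfolding eq by auto
    qed (use E in auto)
  qed
  ultimately show ?thesis by (rule star_configI)
qed

text \<open>There are three cases. If the new edge and \<open>w\<close> lie in the root,
  \<open>X\<close> splits off as a further block hanging on \<open>w\<close>. If the root is only
  the new edge, removing it disconnects the configuration, which is then stuck. If the new edge lies
  in a block, everything turns out to hang on \<open>w\<close>, which gives a star.\<close>

lemma rooted_config_back:
  assumes "card X = s" "card Y = t" "2 < s" "s < t" "rooted_config V s (insert {a, b} M)"
  shows "rooted_config V s M \<or> star_config V s M \<or> stuck_config V s M"
proof -
  obtain R \<D> f where C0: "R \<union> \<Union>\<D> = V" "R \<inter> \<Union>\<D> = {}" "disjoint \<D>" "tight (insert {a, b} M) R"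
     "\<forall>D\<in>\<D>. card D = s \<and> f D \<in> R \<and> tight (insert {a, b} M) (insert (f D) D)"
     "\<forall>e\<in>insert {a, b} M. e \<subseteq> R \<or> (\<exists>D\<in>\<D>. e \<subseteq> insert (f D) D)"
    using assms(5) unfolding rooted_config_def by (elim exE conjE) (rule that)
  note C = C0(1-4) C0(5)[rule_format, THEN conjunct1] C0(5)[rule_format, THEN conjunct2, THEN conjunct1]
    C0(5)[rule_format, THEN conjunct2, THEN conjunct2] C0(6)[rule_format]
  have RV: "R \<subseteq> V" using C(1) by auto
  have DV: "D \<subseteq> V" "insert (f D) D \<subseteq> V" "f D \<notin> D" "R \<inter> D = {}" "D \<noteq> {}" "finite D" if "D \<in> \<D>" for D
  proof -
    show D: "D \<subseteq> V" using C(1) that by auto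
    then show "insert (f D) D \<subseteq> V" using RV C(6)[OF that] by auto
    show "R \<inter> D = {}" using C(2) that by auto
    then show "f D \<notin> D" using C(6)[OF that] by auto
    show "D \<noteq> {}" using C(5)[OF that] assms by auto
    show "finite D" using D fin finite_subset by auto
  qed
  have disj: "D \<inter> E = {}" if "D \<in> \<D>" "E \<in> \<D>" "D \<noteq> E" for D E
    using C(3) that by (meson disjointD)
  show ?thesis
  proof (cases "{a, b} \<subseteq> R")
    case abR: True
    have nab: "\<not> {a, b} \<subseteq> insert (f D) D" if "D \<in> \<D>" for D
      using DV(4)[OF that] abR ab by auto
    note tD = tight_insert_outside[OF C(7) nab]
    have side: "insert (f D) D \<inter> X = {} \<or> insert (f D) D \<inter> Y = {}" if "D \<in> \<D>" for D
      using tight_side[OF C(7)[OF that] DV(2)[OF that] nab[OF that]] .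
    show ?thesis
    proof (cases "w \<in> R")
      case True
      have "w \<in> R \<and> tight M (R - Y) \<and> tight M (R - X)" using tight_split[OF C(4) RV abR] True by auto
      then have w: "w \<in> R" and tR: "tight M (R - Y)" "tight M (R - X)" by auto
      \<comment> \<open>A block meeting \<open>X\<close> would be contained in \<open>X\<close>,
        hence equal to it by size, although \<open>a\<close> is in the root.\<close>
      have DX: "insert (f D) D \<inter> X = {}" if "D \<in> \<D>" for D
      proof (rule ccontr)
        assume "insert (f D) D \<inter> X \<noteq> {}"
        then have "D \<subseteq> X" using side[OF that] DV[OF that] w V by auto
        then have "D = X" using card_subset_eq[OF finX] C(5)[OF that] assms by auto
        then show False using a abR DV(4)[OF that] by auto
      qed
      have "X \<subseteq> R \<union> \<Union>\<D>" using C(1) V by auto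
      then have XR: "X \<subseteq> R" using DX by blast
      have eq: "insert w X = R - Y" using w XR RV V wY XY by auto
      let ?f = "f(X := w)" and ?\<D> = "insert X \<D>"
      have XD: "X \<notin> \<D>" using XR DV(4,5) by blast
      have fD: "?f D = f D" if "D \<in> \<D>" for D using that XD by auto
      have "(R - X) \<union> \<Union>?\<D> = V" using C(1) XR by auto
      moreover have "(R - X) \<inter> \<Union>?\<D> = {}" using C(2) by auto
      moreover have "disjoint ?\<D>" using C(3) DX by (auto simp: pairwise_insert disjnt_def)
      moreover have "card D = s \<and> ?f D \<in> R - X \<and> tight M (insert (?f D) D)" if "D \<in> ?\<D>" for D
      proof (cases "D = X")
        case True then show ?thesis using assms(1) w wX tR eq by auto
      next
        case False
        then have "D \<in> \<D>" using that by auto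
        then show ?thesis using fD C(5,6) tD DX by auto
      qed
      moreover have "e \<subseteq> R - X \<or> (\<exists>D\<in>?\<D>. e \<subseteq> insert (?f D) D)" if "e \<in> M" for e
      proof (cases "e \<subseteq> R")
        case True
        then have "e \<subseteq> R - X \<or> e \<subseteq> R - Y" using edge_side[OF that] by auto
        then show ?thesis using eq by auto
      next
        case False
        then obtain D where "D \<in> \<D>" "e \<subseteq> insert (f D) D" using C(8)[of e] \<open>e \<in> M\<close> by auto
        then show ?thesis using fD by auto
      qed
      ultimately have "rooted_config V s M" by (rule rooted_configI[OF _ _ _ tR(2), where f = ?f])
      then show ?thesis ..
    next
      case False
      then have R: "R = {a, b}" using tight_split[OF C(4) RV abR] by auto
      have "w \<in> V" using V by auto
      then obtain D0 where D0: "D0 \<in> \<D>" "w \<in> D0" using False C(1) by auto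
      have others: "D \<subseteq> X \<and> f D = a \<or> D \<subseteq> Y \<and> f D = b" if "D \<in> \<D>" "D \<noteq> D0" for D
      proof -
        have "w \<notin> D" using disj[OF that(1) D0(1) that(2)] D0 by auto
        then show ?thesis using side[OF that(1)] DV(1)[OF that(1)] C(6)[OF that(1)] V R a b XY by auto
      qed
      \<comment> \<open>A block hanging on \<open>a\<close> inside \<open>X\<close> would put
        \<open>s + 1\<close> vertices into \<open>X\<close>.\<close>
      have oth: "D \<subseteq> Y" "f D = b" if D: "D \<in> \<D>" "D \<noteq> D0" for D
      proof -
        have "\<not> (D \<subseteq> X \<and> f D = a)"
        proof
          assume "D \<subseteq> X \<and> f D = a"
          then have "insert a D \<subseteq> X" "a \<notin> D" using a DV(3)[OF D(1)] by auto
          then have "card (insert a D) \<le> s" using card_mono[OF finX] assms by auto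
          then show False using \<open>a \<notin> D\<close> C(5)[OF D(1)] DV(6)[OF D(1)] by simp
        qed
        then show "D \<subseteq> Y" "f D = b" using others[OF D] by auto
      qed
      \<comment> \<open>If \<open>D0\<close> hung on \<open>b\<close> as well, nothing but
        \<open>a\<close> would be left for \<open>X\<close>.\<close>
      have fD0: "f D0 = a"
      proof (rule ccontr)
        assume "f D0 \<noteq> a"
        then have "f D0 = b" using C(6)[OF D0(1)] R by auto
        then have D0X: "D0 \<inter> X = {}" using side[OF D0(1)] b by auto
        have "x = a" if "x \<in> X" for x
        proof -
          have "x \<in> R \<union> \<Union>\<D>" using that C(1) V by auto
          then show ?thesis using that R ab D0X oth(1) XY by blast
        qed
        then have "X \<subseteq> {a}" by auto
        then have "card X \<le> 1" using card_mono[of "{a}" X] by auto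
        then show False using assms by auto
      qed
      let ?K = "insert a D0" and ?\<D> = "\<D> - {D0}"
      have notin: "a \<notin> \<Union>\<D>" "b \<notin> \<Union>\<D>" using C(2) R by auto
      have "?K \<union> insert b (\<Union>?\<D>) = V" using C(1) R D0(1) by blast
      moreover have "?K \<inter> insert b (\<Union>?\<D>) = {}" "b \<notin> \<Union>?\<D>"
        using notin ab D0(1) disj[OF D0(1)] by auto
      moreover have "disjoint ?\<D>" using C(3) by (rule pairwise_subset) auto
      moreover have "card ?K = s + 1" using DV(3)[OF D0(1)] fD0 C(5)[OF D0(1)] DV(6)[OF D0(1)] by auto
      moreover have "tight M ?K" using tD[OF D0(1) D0(1)] fD0 by auto
      moreover have "card D = s \<and> tight M (insert b D)" if "D \<in> ?\<D>" for D
        using that C(5) tD[of D] oth(2)[of D] by auto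
      moreover have "e \<subseteq> ?K \<or> (\<exists>D\<in>?\<D>. e \<subseteq> insert b D)" if "e \<in> M" for e
      proof -
        have "\<not> e \<subseteq> R"
        proof
          assume "e \<subseteq> R"
          moreover have "card e = 2" using that M by (auto simp: nsets_def)
          ultimately have "e = R" using R ab card_subset_eq[of R e] by auto
          then show False using that R ab by auto
        qed
        then obtain D where "D \<in> \<D>" "e \<subseteq> insert (f D) D" using C(8)[of e] \<open>e \<in> M\<close> by auto
        then show ?thesis using fD0 oth(2) by (cases "D = D0") auto
      qed
      ultimately have "stuck_config V s M" by (rule stuck_configI)
      then show ?thesis by simp
    qed
  next
    case abR: False
    then obtain D where D: "D \<in> \<D>" and abD: "{a, b} \<subseteq> insert (f D) D" using C(8)[of "{a, b}"] by auto
    let ?u = "f D"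
    have cD: "card (insert ?u D) = s + 1" using DV[OF D] C(5)[OF D] by simp
    have ab2: "card {a, b} = 2" using ab by simp
    have "card (insert ?u D) \<noteq> card {a, b}" unfolding cD ab2 using assms by simp
    then have "insert ?u D \<noteq> {a, b}" by metis
    then have w: "w \<in> insert ?u D" and tD: "tight M (insert ?u D - Y)" "tight M (insert ?u D - X)"
      using tight_split[OF C(7)[OF D] DV(2)[OF D] abD] by blast+
    have tR: "tight M R" using tight_insert_outside[OF C(4) abR] .
    have Rside: "R \<inter> X = {} \<or> R \<inter> Y = {}" using tight_side[OF C(4) RV abR] .
    have nab: "\<not> {a, b} \<subseteq> insert (f E) E" if "E \<in> \<D>" "E \<noteq> D" for E
      using abD disj[OF that(1) D that(2)] ab DV(4)[OF D] DV(4)[OF that(1)] C(6)[OF D] C(6)[OF that(1)] by auto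
    have EX: "E \<subseteq> Y" "f E \<notin> X" if E: "E \<in> \<D>" "E \<noteq> D" for E
    proof -
      have side: "insert (f E) E \<inter> X = {} \<or> insert (f E) E \<inter> Y = {}"
        using tight_side[OF C(7)[OF E(1)] DV(2)[OF E(1)] nab[OF E]] .
      have uE: "?u \<notin> E" using C(6)[OF D] DV(4)[OF E(1)] by auto
      then have wE: "w \<notin> E" using w disj[OF E(1) D E(2)] by auto
      have "insert (f E) E \<inter> X = {}"
      proof (rule ccontr)
        assume "insert (f E) E \<inter> X \<noteq> {}"
        then have "E \<subseteq> X" using side DV(1)[OF E(1)] wE V by auto
        then have "E = X" using card_subset_eq[OF finX] C(5)[OF E(1)] assms by auto
        then show False using a abD uE disj[OF E(1) D E(2)] by auto
      qed
      then show "E \<subseteq> Y" "f E \<notin> X" using DV(1)[OF E(1)] wE V by auto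
    qed
    \<comment> \<open>Otherwise \<open>X\<close> would lie in \<open>insert (f D) D\<close>, whose
      \<open>s + 1\<close> vertices include \<open>w\<close> and \<open>b\<close>, both outside
      \<open>X\<close>.\<close>
    have "R \<inter> X \<noteq> {}"
    proof
      assume RX: "R \<inter> X = {}"
      have "X \<subseteq> insert ?u D"
      proof
        fix x assume x: "x \<in> X"
        then have "x \<in> R \<union> \<Union>\<D>" using C(1) V by auto
        then show "x \<in> insert ?u D" using x RX EX(1) XY by blast
      qed
      then have "X \<subseteq> insert ?u D - {w, b}" using wX ab by auto
      then have "card X + 2 \<le> card (insert ?u D)"
        by (rule card_le_minus_one) (use DV(6)[OF D] w abD ab in auto)
      then show False using cD assms by auto
    qed
    then have RX: "R - {w} \<subseteq> X" using Rside RV V by auto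
    \<comment> \<open>If \<open>w\<close> were inside \<open>D\<close>, the root would lie in
      \<open>X\<close>, no other block could be attached to it, and \<open>D\<close> would have to
      contain all \<open>t > s\<close> vertices of \<open>Y\<close>.\<close>
    have wu: "w = ?u"
    proof (rule ccontr)
      assume "w \<noteq> ?u"
      then have "w \<in> D" using w by auto
      then have "w \<notin> R" using DV(4)[OF D] by auto
      then have "R \<subseteq> X" using RX by auto
      then have "E = D" if "E \<in> \<D>" for E using EX(2)[OF that] C(6)[OF that] by auto
      then have "Y \<subseteq> D" using C(1) V \<open>R \<subseteq> X\<close> XY by blast
      then have "card Y \<le> card D" using card_mono DV(6)[OF D] by auto
      then show False using C(5)[OF D] assms by auto
    qed
    have fE: "f E = w" if "E \<in> \<D>" for E
      using EX(2)[OF that] C(6)[OF that] RX wu by (cases "E = D") auto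
    have wR: "w \<in> R" using wu C(6)[OF D] by auto
    have eq: "insert ?u D - Y = insert w (D \<inter> X)" "insert ?u D - X = insert w (D \<inter> Y)"
      using wu wX wY DV[OF D] V XY by auto
    have De: "D = D \<inter> X \<union> D \<inter> Y" using wu DV(1,3)[OF D] V by auto
    \<comment> \<open>The former root becomes an ordinary block: without \<open>w\<close> it lies in
      \<open>X\<close>, so it has at most \<open>s\<close> vertices.\<close>
    let ?\<D> = "insert (R - {w}) (insert (D \<inter> X) (insert (D \<inter> Y) (\<D> - {D})))"
    have U: "\<Union>?\<D> = (R - {w}) \<union> \<Union>\<D>" using D De by blast
    then have "insert w (\<Union>?\<D>) = V" using C(1) wR by auto
    moreover have "w \<notin> \<Union>?\<D>" unfolding U using C(2) wR by auto
    moreover have "disjoint ?\<D>"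
    proof -
      have "disjoint (\<D> - {D})" using C(3) by (rule pairwise_subset) auto
      then show ?thesis using disj[OF _ D] DV(4) D XY by (auto simp: pairwise_insert disjnt_def)
    qed
    moreover have "card E \<le> s \<and> tight M (insert w E)" if "E \<in> ?\<D>" for E
    proof -
      consider "E = R - {w}" | "E = D \<inter> X \<or> E = D \<inter> Y" | "E \<in> \<D>" "E \<noteq> D" using \<open>E \<in> ?\<D>\<close> by auto
      then show ?thesis
      proof cases
        case 1
        then have "card E \<le> s" using RX card_mono[OF finX] assms by auto
        then show ?thesis using 1 tR wR by (simp add: insert_absorb)
      next
        case 2
        then have "card E \<le> card D" using DV(6)[OF D] by (auto intro: card_mono)
        then show ?thesis using 2 tD C(5)[OF D] unfolding eq by auto
      next
        case 3
        then show ?thesis using tight_insert_outside[OF C(7) nab] fE C(5) by fastforce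
      qed
    qed
    moreover have "\<exists>E\<in>?\<D>. e \<subseteq> insert w E" if "e \<in> M" for e
    proof -
      from C(8)[of e] that consider "e \<subseteq> R" | E where "E \<in> \<D>" "e \<subseteq> insert (f E) E" by auto
      then show ?thesis
      proof cases
        case (2 E)
        show ?thesis
        proof (cases "E = D")
          case True
          then have "e \<subseteq> insert ?u D - X \<or> e \<subseteq> insert ?u D - Y" using edge_side[OF that] 2 by auto
          then show ?thesis unfolding eq by auto
        qed (use 2 fE in auto)
      qed auto
    qed
    ultimately have "star_config V s M" by (rule star_configI)
    then show ?thesis by simp
  qed
qed

end

text \<open>Each shape leads to one of the shapes with one insertion undone, so some shape would
  survive down to the empty edge set. There no set is tight, and a star without blocks would mean
  \<open>V = {u}\<close>.\<close>

lemma no_config: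
  assumes "fillable (splits V s t) M" "finite V" "card V = s + t + 1" "2 < s" "s < t"
  shows "\<not> rooted_config V s M \<and> \<not> star_config V s M \<and> \<not> stuck_config V s M"
  using assms
proof (induction rule: fillable.induct)
  case fillable_empty
  have nt: "tight {} T = False" for T :: "'a set" using tight_nonempty[of "{}" T] by (auto simp: induced_def)
  have "\<not> rooted_config V s {}" "\<not> stuck_config V s {}"
    unfolding rooted_config_def stuck_config_def nt by simp_all
  moreover have "\<not> star_config V s {}"
  proof
    assume "star_config V s {}"
    then obtain u \<D> where "insert u (\<Union>\<D>) = V" "\<forall>D\<in>\<D>. False" unfolding star_config_def nt by auto
    then have "V = {u}" by auto
    then show False using fillable_empty by auto
  qed
  ultimately show ?case by simp
next
  case (fillable_insert M X Y x y)
  have c: "card X = s" "card Y = t" using fillable_insert by (auto simp: splits_def)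
  have "M \<subseteq> [V]\<^bsup>2\<^esup>" "sparse V M"
    using fillable_splits_subset[OF fillable_insert.hyps(1)] fillable_sparse[OF fillable_insert.hyps(1)] fillable_insert.prems by auto
  then obtain w where w: "edge_step V X Y w x y M"
    by (rule fillable_splits_edge_step[OF fillable_insert.prems(1,2) fillable_insert.hyps(2-5)])
  show ?case
    using edge_step.no_stuck_config[OF w c] edge_step.star_config_back[OF w c]
      edge_step.rooted_config_back[OF w c] fillable_insert by blast
qed

text \<open>Sparsity alone gives \<open>2 * card V - 3\<close>. Equality would make \<open>V\<close>
  tight, which is a \<open>rooted_config\<close> with root \<open>V\<close> and no blocks.\<close>

lemma card_fillable_le:
  assumes "fillable (splits V s t) M" "finite V" "card V = s + t + 1" "2 < s" "s < t"
  shows "card M + 4 \<le> 2 * card V"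
proof (rule ccontr)
  assume c: "\<not> ?thesis"
  have "M \<subseteq> [V]\<^bsup>2\<^esup>" using fillable_splits_subset[OF assms(1)] .
  then have eV: "e \<subseteq> V" if "e \<in> M" for e using that by (auto simp: nsets_def)
  then have "induced M V = M" by (auto simp: induced_def)
  then have "tight M V" using fillable_sparse[OF assms(1-3)] assms c by (auto simp: sparse_def tight_def)
  then have "rooted_config V s M" using eV by (intro rooted_configI[of V "{}"]) auto
  then show False using no_config assms by blast
qed

section \<open>Construction of large fillable sets\<close>

definition star :: "'a \<Rightarrow> 'a set \<Rightarrow> 'a set set" where
  "star c L = (\<lambda>v. {c, v}) ` L"

lemma mem_star: "{x, y} \<in> star c L \<longleftrightarrow> x = c \<and> y \<in> L \<or> y = c \<and> x \<in> L"
  by (auto simp: star_def doubleton_eq_iff image_iff)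

lemma fillable_insert_sym:
  assumes "fillable P M" "(X, Y) \<in> P \<or> (Y, X) \<in> P" "\<forall>x\<in>X. \<forall>y\<in>Y. {x, y} \<notin> M" "x \<in> X" "y \<in> Y"
  shows "fillable P (insert {x, y} M)"
  using assms(2)
proof
  assume "(Y, X) \<in> P"
  moreover have "\<forall>y\<in>Y. \<forall>x\<in>X. {y, x} \<notin> M" using assms(3) by (metis insert_commute)
  ultimately have "fillable P (insert {y, x} M)" using assms by (intro fillable_insert)
  then show ?thesis by (simp add: insert_commute)
qed (use assms in \<open>auto intro: fillable_insert\<close>)

lemma fillable_splits_swap: "fillable (splits V s t) M \<Longrightarrow> fillable (splits V t s) M"
proof (induction rule: fillable.induct)
  case (fillable_insert M X Y x y)
  then have "(Y, X) \<in> splits V t s" by (auto simp: splits_def)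
  with fillable_insert show ?case by (auto intro: fillable_insert_sym)
qed (rule fillable_empty)

text \<open>In the split for the leaf \<open>v\<close>, no other leaf is on the side of
  \<open>v\<close>, and \<open>c\<close> is opposite. Hence star edges inserted before do not cross
  it, and the leaves can be treated in any order.\<close>

lemma fillable_star:
  assumes "fillable P M" "finite M" "finite L"
    and side: "\<And>v. v \<in> L \<Longrightarrow> \<exists>X Y. ((X, Y) \<in> P \<or> (Y, X) \<in> P) \<and> v \<in> X \<and> c \<in> Y \<and> X \<inter> Y = {} \<and>
      X \<inter> L = {v} \<and> (\<forall>x\<in>X. \<forall>y\<in>Y. {x, y} \<notin> M)"
  shows "fillable P (M \<union> star c L) \<and> card (M \<union> star c L) = card M + card L"
  using \<open>finite L\<close> subset_refl
proof (induction rule: finite_subset_induct')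
  case empty
  show ?case using assms by (simp add: star_def)
next
  case (insert v N)
  obtain X Y where XY: "(X, Y) \<in> P \<or> (Y, X) \<in> P" "v \<in> X" "c \<in> Y" "X \<inter> Y = {}" "X \<inter> L = {v}"
    "\<forall>x\<in>X. \<forall>y\<in>Y. {x, y} \<notin> M"
    using side[OF \<open>v \<in> L\<close>] by blast
  have cross: "\<forall>x\<in>X. \<forall>y\<in>Y. {x, y} \<notin> M \<union> star c N"
    using XY insert by (auto simp: mem_star)
  have eq: "M \<union> star c (insert v N) = insert {v, c} (M \<union> star c N)" by (auto simp: star_def)
  have "{v, c} \<notin> M \<union> star c N" using cross XY by blast
  moreover have "finite (M \<union> star c N)" using insert assms by (simp add: star_def)
  ultimately have "card (M \<union> star c (insert v N)) = Suc (card (M \<union> star c N))" unfolding eq by simp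
  then show ?case unfolding eq using fillable_insert_sym[OF _ XY(1) cross XY(2,3)] insert by simp
qed

text \<open>A filling process inside \<open>B\<close> is repeated in a larger system. Since
  \<open>card B = a + b\<close>, a split of \<open>B\<close> covers \<open>B\<close>, so its
  extension is crossed by no further edges of \<open>N\<close>.\<close>

lemma fillable_lift:
  assumes "fillable (splits B a b) N" "card B = a + b" "finite B" "fillable Q M" "finite M"
    and side: "\<And>X Y. (X, Y) \<in> splits B a b \<Longrightarrow> X \<union> Y = B \<Longrightarrow> \<exists>X' Y'. (X', Y') \<in> Q \<and> X' \<inter> Y' = {} \<and> X \<subseteq> X' \<and> Y \<subseteq> Y' \<and>
      (\<forall>x\<in>X'. \<forall>y\<in>Y'. {x, y} \<notin> M)"
  shows "fillable Q (M \<union> N) \<and> card (M \<union> N) = card M + card N"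
  using assms(1)
proof (induction rule: fillable.induct)
  case fillable_empty
  show ?case using assms by simp
next
  case (fillable_insert N X Y x y)
  have N: "N \<subseteq> [B]\<^bsup>2\<^esup>" using fillable_splits_subset[OF fillable_insert.hyps(1)] .
  have "X \<union> Y \<subseteq> B" "card (X \<union> Y) = card B"
    using fillable_insert.hyps(2) assms(2,3)
    by (auto simp: splits_def intro!: card_Un_disjoint intro: finite_subset)
  then have B: "X \<union> Y = B" using card_subset_eq assms(3) by blast
  obtain X' Y' where XY: "(X', Y') \<in> Q" "X' \<inter> Y' = {}" "X \<subseteq> X'" "Y \<subseteq> Y'"
    "\<forall>x\<in>X'. \<forall>y\<in>Y'. {x, y} \<notin> M"
    using side[OF fillable_insert.hyps(2) B] by blast
  have cross: "\<forall>x\<in>X'. \<forall>y\<in>Y'. {x, y} \<notin> M \<union> N"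
  proof (intro ballI)
    fix x y assume xy: "x \<in> X'" "y \<in> Y'"
    have "{x, y} \<notin> N"
    proof
      assume xyN: "{x, y} \<in> N"
      then have "x \<in> B" "y \<in> B" using N by (auto simp: nsets_def)
      then have "x \<in> X" "y \<in> Y" using xy B XY by auto
      then show False using fillable_insert.hyps(3) xyN by auto
    qed
    then show "{x, y} \<notin> M \<union> N" using xy XY by auto
  qed
  have "{x, y} \<notin> M \<union> N" "{x, y} \<notin> N" using cross fillable_insert.hyps XY by blast+
  moreover have "finite N" using N assms(3) finite_imp_finite_nsets finite_subset by blast
  moreover have "fillable Q (insert {x, y} (M \<union> N))"
  proof (rule fillable.fillable_insert[OF _ XY(1) cross])
    show "fillable Q (M \<union> N)" using fillable_insert.IH by simp
    show "x \<in> X'" "y \<in> Y'" using fillable_insert.hyps XY by auto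
  qed
  ultimately show ?case using fillable_insert assms(5) by simp
qed

text \<open>The subtractive Euclidean algorithm: separate a set \<open>S\<close> of size \<open>a\<close>, make it a star, treat
  the rest with \<open>(a, b - a)\<close>, and join the two trees by an edge.\<close>

lemma fillable_tree_step:
  fixes B :: "'a set"
  assumes "finite B" "card B = a + b" "coprime a b" "0 < a" "0 < b" "a \<le> b"
    and IH: "\<And>R :: 'a set. a < b \<Longrightarrow> finite R \<Longrightarrow> card R = b \<Longrightarrow> \<exists>N. fillable (splits R a (b - a)) N \<and> card N + 1 = b"
  shows "\<exists>N. fillable (splits B a b) N \<and> card N + 1 = a + b"
proof -
  obtain S where S: "S \<subseteq> B" "card S = a" "finite S"
    using obtain_subset_with_card_n[of a B] assms by auto
  define R where "R = B - S"
  have R: "card R = b" "finite R" "S \<inter> R = {}" "B = S \<union> R"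
    using S assms by (auto simp: R_def card_Diff_subset)
  obtain p where p: "p \<in> S" using S assms by fastforce
  obtain r where r: "r \<in> R" using R assms by fastforce
  \<comment> \<open>\<open>T\<close> serves as padding: \<open>insert v T\<close> has
    \<open>a\<close> elements and separates \<open>v\<close> from the rest of
    \<open>S\<close>.\<close>
  obtain T where T: "T \<subseteq> R" "card T = a - 1" "finite T"
    using obtain_subset_with_card_n[of "a - 1" R] R(1) assms(6) by (metis diff_le_self le_trans)
  have "fillable (splits B a b) ({} \<union> star p (S - {p})) \<and>
      card ({} \<union> star p (S - {p})) = card ({} :: 'a set set) + card (S - {p})"
  proof (rule fillable_star)
    fix v assume v: "v \<in> S - {p}"
    have vT: "v \<notin> T" using v T R by auto
    have "insert v T \<subseteq> B" using v T S R by auto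
    then have "(insert v T, B - insert v T) \<in> splits B a b"
      using vT T assms by (auto simp: splits_def card_Diff_subset)
    then show "\<exists>X Y. ((X, Y) \<in> splits B a b \<or> (Y, X) \<in> splits B a b) \<and> v \<in> X \<and> p \<in> Y \<and> X \<inter> Y = {} \<and>
        X \<inter> (S - {p}) = {v} \<and> (\<forall>x\<in>X. \<forall>y\<in>Y. {x, y} \<notin> {})"
      using v p T R by (intro exI[of _ "insert v T"] exI[of _ "B - insert v T"]) auto
  qed (use S in \<open>auto intro: fillable_empty\<close>)
  then have M: "fillable (splits B a b) (star p (S - {p}))" "card (star p (S - {p})) = a - 1"
    using p S by auto
  have finM: "finite (star p (S - {p}))" using S by (simp add: star_def)
  obtain N where N: "fillable (splits B a b) (star p (S - {p}) \<union> N)" "N \<subseteq> [R]\<^bsup>2\<^esup>"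
    "card (star p (S - {p}) \<union> N) = a - 1 + (b - 1)"
  proof (cases "a = b")
    case True
    \<comment> \<open>Coprimality leaves only \<open>a = b = 1\<close>, where \<open>R\<close> is a
      single vertex and no tree on it is needed.\<close>
    then have "b = 1" using assms by simp
    then show ?thesis using that[of "{}"] M by auto
  next
    case False
    then have ab: "a < b" using assms(6) by auto
    then obtain N where N: "fillable (splits R a (b - a)) N" "card N + 1 = b"
      using IH[of R] ab R by auto
    have "fillable (splits B a b) (star p (S - {p}) \<union> N) \<and>
        card (star p (S - {p}) \<union> N) = card (star p (S - {p})) + card N"
    proof (rule fillable_lift[OF N(1)])
      \<comment> \<open>Putting \<open>S\<close> on the side of \<open>Y\<close> raises its size
        from \<open>b - a\<close> to \<open>b\<close> and keeps the star on \<open>S\<close>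
        uncut.\<close>
      fix X Y assume XY: "(X, Y) \<in> splits R a (b - a)" "X \<union> Y = R"
      then have "X \<subseteq> R" "Y \<subseteq> R" "card Y = b - a" by (auto simp: splits_def)
      moreover from this have "card (Y \<union> S) = b"
        using R S ab by (subst card_Un_disjoint) (auto intro: finite_subset)
      ultimately have "(X, Y \<union> S) \<in> splits B a b" and "X \<subseteq> R"
        using XY R by (auto simp: splits_def)
      show "\<exists>X' Y'. (X', Y') \<in> splits B a b \<and> X' \<inter> Y' = {} \<and> X \<subseteq> X' \<and> Y \<subseteq> Y' \<and>
          (\<forall>x\<in>X'. \<forall>y\<in>Y'. {x, y} \<notin> star p (S - {p}))"
      proof (rule exI[of _ X], rule exI[of _ "Y \<union> S"], intro conjI ballI)
        show "X \<inter> (Y \<union> S) = {}" using XY(1) R(3) \<open>X \<subseteq> R\<close> by (auto simp: splits_def)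
        fix x y assume "x \<in> X"
        then have "x \<notin> S" using \<open>X \<subseteq> R\<close> R(3) by auto
        then show "{x, y} \<notin> star p (S - {p})" using p by (auto simp: mem_star)
      qed (use R \<open>(X, Y \<union> S) \<in> splits B a b\<close> in auto)
    qed (use M R ab finM in auto)
    then show ?thesis using that[of N] fillable_splits_subset[OF N(1)] M N(2) by auto
  qed
  \<comment> \<open>The split into \<open>S\<close> and \<open>R\<close> is still crossed by no
    edge, so one joining edge fits in.\<close>
  have "fillable (splits B a b) (star p (S - {p}) \<union> N \<union> star p {r}) \<and>
      card (star p (S - {p}) \<union> N \<union> star p {r}) = card (star p (S - {p}) \<union> N) + card {r}"
  proof (rule fillable_star[OF N(1)])
    fix v assume "v \<in> {r}"
    moreover have "(S, R) \<in> splits B a b" using R S by (auto simp: splits_def)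
    moreover have "\<forall>x\<in>R. \<forall>y\<in>S. {x, y} \<notin> star p (S - {p}) \<union> N"
      using R(3) N(2) p by (auto simp: mem_star nsets_def)
    ultimately show "\<exists>X Y. ((X, Y) \<in> splits B a b \<or> (Y, X) \<in> splits B a b) \<and> v \<in> X \<and> p \<in> Y \<and> X \<inter> Y = {} \<and>
        X \<inter> {r} = {v} \<and> (\<forall>x\<in>X. \<forall>y\<in>Y. {x, y} \<notin> star p (S - {p}) \<union> N)"
      using r p R(3) by (intro exI[of _ R] exI[of _ S]) auto
  next
    show "finite (star p (S - {p}) \<union> N)"
      using finM N(2) R(2) finite_imp_finite_nsets finite_subset by blast
  qed auto
  then show ?thesis using N(3) assms by (intro exI) (auto)
qed

text \<open>The roles of \<open>a\<close> and \<open>b\<close> can be exchanged, so the Euclidean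
  step with \<open>a \<le> b\<close> suffices; the sum decreases from \<open>a + b\<close> to
  \<open>b\<close>.\<close>

lemma fillable_tree:
  assumes "finite B" "card B = a + b" "coprime a b" "0 < a" "0 < b"
  shows "\<exists>N. fillable (splits B a b) N \<and> card N + 1 = a + b"
  using assms
proof (induction "a + b" arbitrary: a b B rule: less_induct)
  case less
  have main: "\<exists>N. fillable (splits B a' b') N \<and> card N + 1 = a' + b'"
    if "a' + b' = a + b" "coprime a' b'" "0 < a'" "0 < b'" "a' \<le> b'" for a' b'
  proof (rule fillable_tree_step)
    fix R :: "'a set" assume R: "a' < b'" "finite R" "card R = b'"
    have "coprime a' (b' - a')" using that(2) gcd_diff1_nat[OF that(5)]
      by (simp add: coprime_iff_gcd_eq_1 gcd.commute)
    then have "\<exists>N. fillable (splits R a' (b' - a')) N \<and> card N + 1 = a' + (b' - a')"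
      by (intro less.hyps) (use R that in auto)
    then show "\<exists>N. fillable (splits R a' (b' - a')) N \<and> card N + 1 = b'" using R by simp
  qed (use that less.prems in auto)
  show ?case
  proof (cases "a \<le> b")
    case False
    then have "\<exists>N. fillable (splits B b a) N \<and> card N + 1 = b + a"
      using main[of b a] less.prems by (simp add: coprime_commute)
    then show ?thesis using fillable_splits_swap by (metis add.commute)
  qed (use main less.prems in auto)
qed

lemma splits_complement:
  assumes "finite V" "card V = s + t + 1" "X \<subseteq> V" "card X = s" "w \<in> V" "w \<notin> X"
  shows "(X, V - insert w X) \<in> splits V s t"
proof -
  have "finite X" using assms finite_subset by auto
  then have "card (V - insert w X) = card V - card (insert w X)"
    using assms by (intro card_Diff_subset) auto
  also have "\<dots> = t" using assms \<open>finite X\<close> by simp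
  finally show ?thesis using assms by (auto simp: splits_def)
qed

text \<open>\<open>fillable_star\<close> with one deleted vertex \<open>w\<close> for all leaves:
  only the part \<open>X v\<close> of size \<open>s\<close> has to be named, its complement without
  \<open>w\<close> is the other part.\<close>

lemma fillable_star_splits:
  assumes "fillable (splits V s t) M" "finite V" "card V = s + t + 1" "finite L"
    and "w \<in> V" "c \<in> V" "c \<noteq> w"
    and X: "\<And>v. v \<in> L \<Longrightarrow> X v \<subseteq> V \<and> card (X v) = s \<and> w \<notin> X v \<and> c \<notin> X v \<and> v \<in> X v \<and> X v \<inter> L = {v}"
    and cross: "\<And>v x y. v \<in> L \<Longrightarrow> x \<in> X v \<Longrightarrow> y \<in> V \<Longrightarrow> y \<noteq> w \<Longrightarrow> y \<notin> X v \<Longrightarrow> {x, y} \<notin> M"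
  shows "fillable (splits V s t) (M \<union> star c L) \<and> card (M \<union> star c L) = card M + card L"
proof (rule fillable_star[OF assms(1)])
  show "finite M"
    using fillable_splits_subset[OF assms(1)] assms(2) finite_imp_finite_nsets finite_subset by blast
  fix v assume v: "v \<in> L"
  have "(X v, V - insert w (X v)) \<in> splits V s t"
    using X[OF v] assms by (intro splits_complement) auto
  moreover have "\<forall>x\<in>X v. \<forall>y\<in>V - insert w (X v). {x, y} \<notin> M" using cross[OF v] by auto
  ultimately show "\<exists>X Y. ((X, Y) \<in> splits V s t \<or> (Y, X) \<in> splits V s t) \<and> v \<in> X \<and> c \<in> Y \<and> X \<inter> Y = {} \<and>
      X \<inter> L = {v} \<and> (\<forall>x\<in>X. \<forall>y\<in>Y. {x, y} \<notin> M)"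
    using X[OF v] assms(6,7) by (intro exI[of _ "X v"] exI[of _ "V - insert w (X v)"]) auto
qed (rule assms)

text \<open>The edges are filled in batches, with deleted vertex \<open>z\<close> for the first,
  \<open>c\<close> for the next four, and \<open>u\<close> for the tree on \<open>B\<close> and the
  extra edge \<open>{q, z}\<close>. The batches before the extra edge have sizes
  \<open>s + k\<close>, \<open>s - 2\<close>, \<open>k\<close>, \<open>s + r - 1\<close>, 1 and
  \<open>s + r - 1\<close>.\<close>

lemma exists_fillable:
  assumes "2 < s" "0 < r" "coprime s r" "t = s + r + k" "finite V" "card V = s + t + 1"
  shows "\<exists>M. fillable (splits V s t) M \<and> card M = 2 * s + 2 * t - 3 + (if k = 0 then 1 else 0)"
proof -
  have "s - 1 \<le> card V" using assms by simp
  then obtain Q1 where Q1: "Q1 \<subseteq> V" "card Q1 = s - 1" "finite Q1"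
    by (rule obtain_subset_with_card_n)
  have "card (V - Q1) = t + 2" using Q1 assms by (simp add: card_Diff_subset)
  then have "k \<le> card (V - Q1)" using assms by simp
  then obtain Q2 where Q2: "Q2 \<subseteq> V - Q1" "card Q2 = k" "finite Q2"
    by (rule obtain_subset_with_card_n)
  have "card (V - Q1 - Q2) = s + r + 2" using Q2 assms \<open>card (V - Q1) = t + 2\<close> by (simp add: card_Diff_subset)
  then have "s + r \<le> card (V - Q1 - Q2)" by simp
  then obtain B where B: "B \<subseteq> V - Q1 - Q2" "card B = s + r" "finite B"
    by (rule obtain_subset_with_card_n)
  have "card (V - Q1 - Q2 - B) = 2" using B \<open>card (V - Q1 - Q2) = s + r + 2\<close> by (simp add: card_Diff_subset)
  then obtain c u where cu: "V - Q1 - Q2 - B = {c, u}" "c \<noteq> u" by (auto simp: card_2_iff)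
  have Veq: "V = insert c (insert u (Q1 \<union> Q2 \<union> B))" using cu Q1 Q2 B by auto
  have disj: "c \<notin> Q1" "c \<notin> Q2" "c \<notin> B" "u \<notin> Q1" "u \<notin> Q2" "u \<notin> B" "Q1 \<inter> Q2 = {}" "Q1 \<inter> B = {}" "Q2 \<inter> B = {}"
    using cu Q1 Q2 B by auto
  have "Q1 \<noteq> {}" "B \<noteq> {}" using Q1 B assms by auto
  then obtain q z where q: "q \<in> Q1" and z: "z \<in> B" by auto
  \<comment> \<open>\<open>T\<close> pads a vertex outside \<open>B\<close> to a part of size
    \<open>s\<close>; avoiding \<open>z\<close> keeps \<open>z\<close> free to be the deleted
    vertex.\<close>
  have "s - 1 \<le> card (B - {z})" using B z assms by auto
  then obtain T where T: "T \<subseteq> B - {z}" "card T = s - 1" "finite T"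
    by (rule obtain_subset_with_card_n)
  have ne: "q \<noteq> c" "q \<noteq> u" "z \<noteq> c" "z \<noteq> u" "q \<notin> Q2" "q \<notin> B" "z \<notin> Q1" "z \<notin> Q2" using q z disj by auto
  have T': "z \<notin> T" "c \<notin> T" "u \<notin> T" "T \<inter> Q1 = {}" "T \<inter> Q2 = {}" "T \<subseteq> V" "T \<subseteq> B" using T disj Veq by auto
  have mem: "c \<in> V" "u \<in> V" "q \<in> V" "z \<in> V" "Q1 \<subseteq> V" "Q2 \<subseteq> V" "B \<subseteq> V" using Veq q z by auto
  have cT: "card (insert v T) = s" if "v = u \<or> v \<in> Q1 \<or> v \<in> Q2" for v
    using that T' T(2,3) assms(1) by (subst card_insert_disjoint) auto
  have cQ: "card (insert v Q1) = s" if "v \<notin> Q1" for v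
    using that Q1 assms(1) by (subst card_insert_disjoint) auto
  note star = fillable_star_splits[where V = V and s = s and t = t]
  define M1 where "M1 = {} \<union> star c (insert u (Q1 \<union> Q2))"
  have M1: "fillable (splits V s t) M1 \<and> card M1 = card ({} :: 'a set set) + card (insert u (Q1 \<union> Q2))"
    unfolding M1_def
  proof (rule star[where w = z and X = "\<lambda>v. insert v T"])
    show "insert v T \<subseteq> V \<and> card (insert v T) = s \<and> z \<notin> insert v T \<and> c \<notin> insert v T \<and> v \<in> insert v T \<and>
        (insert v T) \<inter> (insert u (Q1 \<union> Q2)) = {v}" if "v \<in> insert u (Q1 \<union> Q2)" for v
      using that T' cT disj ne cu(2) mem by auto
    show "{x, y} \<notin> {}" if "v \<in> insert u (Q1 \<union> Q2)" "x \<in> insert v T" "y \<in> V" "y \<noteq> z" "y \<notin> insert v T" for v x y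
      by simp
  qed (use fillable_empty assms(5,6) mem Q1 Q2 B ne cu(2) in auto)
  \<comment> \<open>Deleting \<open>c\<close> hides all of \<open>M1\<close>, here and in the next
    three batches.\<close>
  define M2 where "M2 = M1 \<union> star q (Q1 - {q})"
  have M2: "fillable (splits V s t) M2 \<and> card M2 = card M1 + card (Q1 - {q})"
    unfolding M2_def
  proof (rule star[where w = c and X = "\<lambda>v. insert v T"])
    show "insert v T \<subseteq> V \<and> card (insert v T) = s \<and> c \<notin> insert v T \<and> q \<notin> insert v T \<and> v \<in> insert v T \<and>
        (insert v T) \<inter> (Q1 - {q}) = {v}" if "v \<in> Q1 - {q}" for v
      using that T' cT disj ne cu(2) mem q by auto
    show "{x, y} \<notin> M1" if "v \<in> Q1 - {q}" "x \<in> insert v T" "y \<in> V" "y \<noteq> c" "y \<notin> insert v T" for v x y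
      using that T' disj ne mem q cu(2) by (auto simp: M1_def mem_star)
  qed (use M1 assms(5,6) mem Q1 Q2 B ne cu(2) in auto)
  define M3 where "M3 = M2 \<union> star u (Q2)"
  have M3: "fillable (splits V s t) M3 \<and> card M3 = card M2 + card (Q2)"
    unfolding M3_def
  proof (rule star[where w = c and X = "\<lambda>v. insert v T"])
    show "insert v T \<subseteq> V \<and> card (insert v T) = s \<and> c \<notin> insert v T \<and> u \<notin> insert v T \<and> v \<in> insert v T \<and>
        (insert v T) \<inter> (Q2) = {v}" if "v \<in> Q2" for v
      using that T' cT disj ne cu(2) mem by auto
    show "{x, y} \<notin> M2" if "v \<in> Q2" "x \<in> insert v T" "y \<in> V" "y \<noteq> c" "y \<notin> insert v T" for v x y
      using that T' disj ne mem q cu(2) by (auto simp: M1_def M2_def mem_star)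
  qed (use M2 assms(5,6) mem Q1 Q2 B ne cu(2) in auto)
  \<comment> \<open>From here on \<open>Q1\<close> is used as padding and stays on one side, so its
    star is not cut.\<close>
  define M4 where "M4 = M3 \<union> star u (B - {z})"
  have M4: "fillable (splits V s t) M4 \<and> card M4 = card M3 + card (B - {z})"
    unfolding M4_def
  proof (rule star[where w = c and X = "\<lambda>v. insert v Q1"])
    show "insert v Q1 \<subseteq> V \<and> card (insert v Q1) = s \<and> c \<notin> insert v Q1 \<and> u \<notin> insert v Q1 \<and> v \<in> insert v Q1 \<and>
        (insert v Q1) \<inter> (B - {z}) = {v}" if "v \<in> B - {z}" for v
      using that cQ disj ne mem by auto
    show "{x, y} \<notin> M3" if "v \<in> B - {z}" "x \<in> insert v Q1" "y \<in> V" "y \<noteq> c" "y \<notin> insert v Q1" for v x y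
      using that disj ne mem q cu(2) by (auto simp: M1_def M2_def M3_def mem_star)
  qed (use M3 assms(5,6) mem Q1 Q2 B ne cu(2) in auto)
  \<comment> \<open>This is why \<open>z\<close> was left out of the star at \<open>u\<close>: it
    completes \<open>Q1\<close> to a part of size \<open>s\<close> with no edge to \<open>u\<close>,
    so \<open>{u, q}\<close> can become the only crossing edge.\<close>
  define M5 where "M5 = M4 \<union> star u {q}"
  have M5: "fillable (splits V s t) M5 \<and> card M5 = card M4 + card {q}"
    unfolding M5_def
  proof (rule star[where w = c and X = "\<lambda>v. insert z Q1"])
    show "insert z Q1 \<subseteq> V \<and> card (insert z Q1) = s \<and> c \<notin> insert z Q1 \<and> u \<notin> insert z Q1 \<and> v \<in> insert z Q1 \<and>
        (insert z Q1) \<inter> {q} = {v}" if "v \<in> {q}" for v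
      using that cQ disj ne mem q z by auto
    show "{x, y} \<notin> M4" if "v \<in> {q}" "x \<in> insert z Q1" "y \<in> V" "y \<noteq> c" "y \<notin> insert z Q1" for v x y
      using that disj ne mem q cu(2) by (auto simp: M1_def M2_def M3_def M4_def mem_star)
  qed (use M4 assms(5,6) mem Q1 Q2 B ne cu(2) in auto)
  obtain N where N: "fillable (splits B s r) N" "card N + 1 = s + r"
    using fillable_tree[of B s r] B assms by auto
  have NB: "N \<subseteq> [B]\<^bsup>2\<^esup>" using fillable_splits_subset[OF N(1)] .
  have M6: "fillable (splits V s t) (M5 \<union> N) \<and> card (M5 \<union> N) = card M5 + card N"
  proof (rule fillable_lift[OF N(1)])
    have "M5 \<subseteq> [V]\<^bsup>2\<^esup>" using M5 fillable_splits_subset by metis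
    then show "finite M5" using finite_imp_finite_nsets[OF assms(5)] finite_subset by metis
    fix X Y assume "(X, Y) \<in> splits B s r" "X \<union> Y = B"
    then have XY: "X \<subseteq> B" "card X = s" "Y = B - X" by (auto simp: splits_def)
    \<comment> \<open>Without \<open>u\<close>, no edge of \<open>M5\<close> touches
      \<open>B\<close>, so all vertices outside \<open>B\<close> may join \<open>Y\<close>, which
      grows from \<open>r\<close> to \<open>t\<close> vertices.\<close>
    have "(X, V - insert u X) \<in> splits V s t"
      using XY disj mem by (intro splits_complement assms) auto
    moreover have "\<forall>x\<in>X. \<forall>y\<in>V - insert u X. {x, y} \<notin> M5"
    proof (intro ballI)
      fix x y assume "x \<in> X" "y \<in> V - insert u X"
      then have "x \<in> B" "y \<noteq> u" using XY by auto
      then show "{x, y} \<notin> M5"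
        using disj ne cu(2) by (auto simp: M1_def M2_def M3_def M4_def M5_def mem_star)
    qed
    moreover have "Y \<subseteq> V - insert u X" using XY mem disj by auto
    ultimately show "\<exists>X' Y'. (X', Y') \<in> splits V s t \<and> X' \<inter> Y' = {} \<and> X \<subseteq> X' \<and> Y \<subseteq> Y' \<and>
        (\<forall>x\<in>X'. \<forall>y\<in>Y'. {x, y} \<notin> M5)"
      by (intro exI[of _ X] exI[of _ "V - insert u X"]) auto
  qed (use B M5 in auto)
  have "card (insert u (Q1 \<union> Q2)) = s + k"
    using disj Q1 Q2 assms(1) by (simp add: card_Un_disjoint)
  moreover have "card (Q1 - {q}) = s - 2" "card (B - {z}) = s + r - 1" using q z Q1 B by auto
  ultimately have c6: "card (M5 \<union> N) = 2 * s + 2 * t - 3"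
    using M1 M2 M3 M4 M5 M6 N(2) Q2(2) assms(1,2,4) by simp
  show ?thesis
  proof (cases "k = 0")
    case True
    then have "Q2 = {}" using Q2 by auto
    \<comment> \<open>With \<open>Q2\<close> empty, deleting \<open>u\<close> leaves the parts
      \<open>insert c Q1\<close> and \<open>B\<close> of sizes \<open>s\<close> and
      \<open>t\<close>, with no edge between them so far.\<close>
    have "fillable (splits V s t) (M5 \<union> N \<union> star z {q}) \<and> card (M5 \<union> N \<union> star z {q}) = card (M5 \<union> N) + card {q}"
    proof (rule star[where w = u and X = "\<lambda>v. insert c Q1"])
      show "insert c Q1 \<subseteq> V \<and> card (insert c Q1) = s \<and> u \<notin> insert c Q1 \<and> z \<notin> insert c Q1 \<and>
          v \<in> insert c Q1 \<and> insert c Q1 \<inter> {q} = {v}" if "v \<in> {q}" for v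
        using that cQ disj ne cu(2) mem q by auto
      fix v x y assume xy: "x \<in> insert c Q1" "y \<in> V" "y \<noteq> u" "y \<notin> insert c Q1"
      then have "y \<in> B" "x \<notin> B" using Veq \<open>Q2 = {}\<close> disj by auto
      then show "{x, y} \<notin> M5 \<union> N"
        using xy(1) NB disj \<open>Q2 = {}\<close> cu(2) q
        by (auto simp: M1_def M2_def M3_def M4_def M5_def mem_star nsets_def)
    qed (use M6 assms(5,6) mem ne in auto)
    then show ?thesis using c6 True by auto
  next
    case False
    then show ?thesis using M6 c6 by auto
  qed
qed

section \<open>Copies of complete bipartite graphs and weak saturation\<close>

definition cross :: "'a set \<Rightarrow> 'a set \<Rightarrow> 'a set set" where
  "cross A B = {{a, b} | a b. a \<in> A \<and> b \<in> B}"

lemma copy_in_complete_bipartiteD: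
  assumes "copy_in (complete_bipartite s t) G H"
  obtains A B where "(A, B) \<in> splits (verts G) s t" "edges H = cross A B" "cross A B \<subseteq> edges G"
proof -
  obtain f where H: "verts H \<subseteq> verts G" "edges H \<subseteq> edges G"
    and f: "bij_betw f ({..<s} <+> {..<t}) (verts H)"
    and e: "edges H = (\<lambda>e. f ` e) ` {{Inl i, Inr j} | i j. i < s \<and> j < t}"
    using assms by (auto simp: copy_in_def subgraph_def isomorphic_def complete_bipartite_def)
  define A B where "A = f ` Inl ` {..<s}" and "B = f ` Inr ` {..<t}"
  have inj: "inj_on f ({..<s} <+> {..<t})" and im: "f ` ({..<s} <+> {..<t}) = verts H"
    using f by (auto simp: bij_betw_def)
  have "A \<union> B = verts H" using im by (auto simp: A_def B_def Plus_def image_Un)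
  moreover have "A \<inter> B = {}"
  proof -
    have "f (Inl i) \<noteq> f (Inr j)" if "i < s" "j < t" for i j
      using inj_onD[OF inj, of "Inl i" "Inr j"] that by auto
    then show ?thesis by (auto simp: A_def B_def)
  qed
  moreover have "card A = s" "card B = t"
  proof -
    have "inj_on f (Inl ` {..<s})" "inj_on f (Inr ` {..<t})"
      using inj by (auto intro: inj_on_subset simp: Plus_def)
    then show "card A = s" "card B = t" by (simp_all add: A_def B_def card_image)
  qed
  moreover have "edges H = cross A B"
  proof
    show "edges H \<subseteq> cross A B" unfolding e cross_def A_def B_def by auto
    show "cross A B \<subseteq> edges H"
    proof
      fix x assume "x \<in> cross A B"
      then obtain i j where "x = {f (Inl i), f (Inr j)}" "i < s" "j < t"
        unfolding cross_def A_def B_def by auto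
      then have "x = f ` {Inl i, Inr j}" "i < s" "j < t" by auto
      then show "x \<in> edges H" unfolding e by blast
    qed
  qed
  ultimately show ?thesis using H by (intro that) (auto simp: splits_def)
qed

lemma copy_in_complete_bipartiteI:
  assumes AB: "(A, B) \<in> splits (verts G) s t" and "finite (verts G)" "cross A B \<subseteq> edges G"
  shows "copy_in (complete_bipartite s t) G (A \<union> B, cross A B)"
proof -
  have "finite A" "finite B" using assms by (auto simp: splits_def intro: finite_subset)
  then obtain g h where g: "bij_betw g {..<s} A" and h: "bij_betw h {..<t} B"
    using AB ex_bij_betw_nat_finite[of A] ex_bij_betw_nat_finite[of B]
    by (auto simp: splits_def atLeast0LessThan)
  let ?f = "case_sum g h"
  have "bij_betw ?f ({..<s} <+> {..<t}) (A \<union> B)"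
    unfolding bij_betw_def
  proof
    show "inj_on ?f ({..<s} <+> {..<t})"
    proof (rule inj_onI)
      fix x y assume "x \<in> {..<s} <+> {..<t}" "y \<in> {..<s} <+> {..<t}" "?f x = ?f y"
      moreover have "g i \<noteq> h j" if "i < s" "j < t" for i j
        using bij_betwE[OF g] bij_betwE[OF h] AB that by (auto simp: splits_def)
      ultimately show "x = y"
        using g h by (auto simp: inj_on_def bij_betw_def) metis+
    qed
    show "?f ` ({..<s} <+> {..<t}) = A \<union> B"
      using g h by (simp add: Plus_def image_Un image_image bij_betw_def)
  qed
  moreover have "cross A B = (\<lambda>e. ?f ` e) ` {{Inl i, Inr j} | i j. i < s \<and> j < t}"
  proof
    show "cross A B \<subseteq> (\<lambda>e. ?f ` e) ` {{Inl i, Inr j} | i j. i < s \<and> j < t}"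
    proof
      fix x assume "x \<in> cross A B"
      then obtain a b where "x = {a, b}" "a \<in> A" "b \<in> B" by (auto simp: cross_def)
      then obtain i j where "x = {g i, h j}" "i < s" "j < t" using g h by (auto simp: bij_betw_def)
      then have "x = ?f ` {Inl i, Inr j}" "i < s" "j < t" by auto
      then show "x \<in> (\<lambda>e. ?f ` e) ` {{Inl i, Inr j} | i j. i < s \<and> j < t}" by blast
    qed
    show "(\<lambda>e. ?f ` e) ` {{Inl i, Inr j} | i j. i < s \<and> j < t} \<subseteq> cross A B"
      using bij_betwE[OF g] bij_betwE[OF h] by (fastforce simp: cross_def)
  qed
  ultimately have "isomorphic (complete_bipartite s t) (A \<union> B, cross A B)"
    unfolding isomorphic_def complete_bipartite_def by auto
  then show ?thesis using assms by (auto simp: copy_in_def subgraph_def splits_def)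
qed

text \<open>The ordering is read from its end. When an edge is added, the edges still missing are
  exactly the later ones, and the copy that the new edge completes uses none of them.\<close>

lemma weakly_saturated_imp_fillable:
  assumes "weakly_saturated (complete_bipartite s t) G"
  shows "fillable (splits (verts G) s t) ([verts G]\<^bsup>2\<^esup> - edges G)"
proof -
  let ?P = "splits (verts G) s t"
  obtain es where es: "distinct es" "set es = [verts G]\<^bsup>2\<^esup> - edges G"
    "\<And>i. i < length es \<Longrightarrow> \<exists>H. copy_in (complete_bipartite s t) (add_edges G (set (take (Suc i) es))) H
      \<and> es ! i \<in> edges H"
    using assms by (auto simp: weakly_saturated_def)
  \<comment> \<open>The induction is on the number \<open>k\<close> of last edges.\<close>
  have "fillable ?P (set (drop (length es - k) es))" if "k \<le> length es" for k
    using that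
  proof (induction k)
    case 0
    show ?case by (simp add: fillable_empty)
  next
    case (Suc k)
    define j where "j = length es - Suc k"
    have j: "j < length es" "length es - k = Suc j" using Suc by (auto simp: j_def)
    obtain H where H: "copy_in (complete_bipartite s t) (add_edges G (set (take (Suc j) es))) H"
      "es ! j \<in> edges H"
      using es(3)[OF j(1)] by auto
    obtain A B where AB: "(A, B) \<in> ?P" "edges H = cross A B"
      "cross A B \<subseteq> edges G \<union> set (take (Suc j) es)"
      using copy_in_complete_bipartiteD[OF H(1)] by (auto simp: add_edges_def)
    obtain x y where xy: "es ! j = {x, y}" "x \<in> A" "y \<in> B" using H(2) AB(2) by (auto simp: cross_def)
    have "set (take (Suc j) es) \<inter> set (drop (Suc j) es) = {}"
      using es(1) by (simp add: set_take_disj_set_drop_if_distinct)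
    moreover have "set (drop (Suc j) es) \<inter> edges G = {}"
      using es(2) set_drop_subset[of "Suc j" es] by auto
    ultimately have "cross A B \<inter> set (drop (Suc j) es) = {}" using AB(3) by blast
    then have "\<forall>x\<in>A. \<forall>y\<in>B. {x, y} \<notin> set (drop (Suc j) es)" by (auto simp: cross_def)
    moreover have "fillable ?P (set (drop (Suc j) es))" using Suc j by simp
    ultimately have "fillable ?P (insert {x, y} (set (drop (Suc j) es)))" using AB(1) xy by (intro fillable_insert)
    moreover have "drop j es = es ! j # drop (Suc j) es" using j by (simp add: Cons_nth_drop_Suc)
    ultimately show ?case using xy by (simp add: j_def)
  qed
  from this[of "length es"] show ?thesis using es(2) by simp
qed

text \<open>The edge inserted last goes to the front of the list, being the first to be filled
  in.\<close>

lemma fillable_imp_list: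
  assumes "fillable (splits V s t) M"
  shows "\<exists>es. distinct es \<and> set es = M \<and> (\<forall>i < length es. \<exists>A B. (A, B) \<in> splits V s t \<and>
    es ! i \<in> cross A B \<and> cross A B \<inter> set (drop (Suc i) es) = {})"
  using assms
proof (induction rule: fillable.induct)
  case (fillable_insert M X Y x y)
  then obtain es where es: "distinct es" "set es = M" "\<forall>i < length es. \<exists>A B. (A, B) \<in> splits V s t \<and>
    es ! i \<in> cross A B \<and> cross A B \<inter> set (drop (Suc i) es) = {}" by auto
  have "\<exists>A B. (A, B) \<in> splits V s t \<and> ({x, y} # es) ! i \<in> cross A B \<and>
      cross A B \<inter> set (drop (Suc i) ({x, y} # es)) = {}" if "i < length ({x, y} # es)" for i
  proof (cases i)
    case 0
    have "{x, y} \<in> cross X Y" "cross X Y \<inter> set es = {}"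
      using fillable_insert.hyps es(2) by (auto simp: cross_def)
    then show ?thesis using fillable_insert.hyps(2) 0 by auto
  next
    case (Suc j)
    then show ?thesis using es(3) that by simp
  qed
  moreover have "distinct ({x, y} # es)" using es fillable_insert.hyps by auto
  ultimately show ?case using es(2) by (intro exI[of _ "{x, y} # es"]) auto
qed simp

text \<open>Maximality supplies the absence of copies: a copy would be a split crossed by no missing
  edge, and then one of its own edges could be inserted into \<open>M\<close>.\<close>

lemma maximal_fillable_imp_weakly_saturated:
  assumes M: "fillable (splits V s t) M" and max: "\<And>M'. fillable (splits V s t) M' \<Longrightarrow> M \<subseteq> M' \<Longrightarrow> M' = M"
    and "finite V" "0 < s" "0 < t"
  shows "weakly_saturated (complete_bipartite s t) (V, [V]\<^bsup>2\<^esup> - M)"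
proof -
  let ?G = "(V, [V]\<^bsup>2\<^esup> - M)"
  have MV: "M \<subseteq> [V]\<^bsup>2\<^esup>" using fillable_splits_subset[OF M] .
  have "\<not> copy_in (complete_bipartite s t) ?G H" for H
  proof
    assume "copy_in (complete_bipartite s t) ?G H"
    then obtain A B where AB: "(A, B) \<in> splits V s t" "cross A B \<subseteq> [V]\<^bsup>2\<^esup> - M"
      by (auto elim: copy_in_complete_bipartiteD)
    then have "A \<noteq> {}" "B \<noteq> {}" using assms by (auto simp: splits_def)
    then obtain a b where ab: "a \<in> A" "b \<in> B" by auto
    have nM: "\<forall>x\<in>A. \<forall>y\<in>B. {x, y} \<notin> M" using AB(2) by (auto simp: cross_def)
    then have "fillable (splits V s t) (insert {a, b} M)" using fillable_insert[OF M AB(1)] ab by auto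
    then have "{a, b} \<in> M" using max[of "insert {a, b} M"] by auto
    then show False using nM ab by auto
  qed
  moreover obtain es where es: "distinct es" "set es = M" "\<And>i. i < length es \<Longrightarrow> \<exists>A B. (A, B) \<in> splits V s t \<and>
    es ! i \<in> cross A B \<and> cross A B \<inter> set (drop (Suc i) es) = {}"
    using fillable_imp_list[OF M] by auto
  have "\<exists>H. copy_in (complete_bipartite s t) (add_edges ?G (set (take (Suc i) es))) H \<and> es ! i \<in> edges H"
    if i: "i < length es" for i
  proof -
    obtain A B where AB: "(A, B) \<in> splits V s t" "es ! i \<in> cross A B"
      "cross A B \<inter> set (drop (Suc i) es) = {}"
      using es(3)[OF i] by auto
    have "M = set (take (Suc i) es) \<union> set (drop (Suc i) es)"
      using es(2) by (metis append_take_drop_id set_append)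
    moreover have "cross A B \<subseteq> [V]\<^bsup>2\<^esup>"
    proof
      fix e assume "e \<in> cross A B"
      then obtain a b where "e = {a, b}" "a \<in> A" "b \<in> B" by (auto simp: cross_def)
      moreover from this have "a \<noteq> b" using AB(1) by (auto simp: splits_def)
      ultimately show "e \<in> [V]\<^bsup>2\<^esup>" using AB(1) by (auto simp: splits_def nsets_def)
    qed
    ultimately have "cross A B \<subseteq> ([V]\<^bsup>2\<^esup> - M) \<union> set (take (Suc i) es)" using AB(3) by auto
    then have "copy_in (complete_bipartite s t) (add_edges ?G (set (take (Suc i) es))) (A \<union> B, cross A B)"
      using AB(1) assms by (intro copy_in_complete_bipartiteI) (auto simp: add_edges_def)
    then show ?thesis using AB(2) by auto
  qed
  moreover have "[V]\<^bsup>2\<^esup> - ([V]\<^bsup>2\<^esup> - M) = M" using MV by auto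
  ultimately show ?thesis unfolding weakly_saturated_def using es(1,2)
    by (intro conjI exI[of _ es]) auto
qed

text \<open>\<open>M\<close> is enlarged to an inclusion-maximal fillable set, whose complement is
  taken; hence only an inequality for the sizes.\<close>

lemma exists_weakly_saturated:
  assumes "fillable (splits V s t) M" "finite V" "0 < s" "0 < t"
  shows "\<exists>E. E \<subseteq> [V]\<^bsup>2\<^esup> \<and> weakly_saturated (complete_bipartite s t) (V, E) \<and>
    card E + card M \<le> card V choose 2"
proof -
  have fin2: "finite ([V]\<^bsup>2\<^esup>)" using assms by (simp add: finite_imp_finite_nsets)
  have "{M. fillable (splits V s t) M} \<subseteq> Pow ([V]\<^bsup>2\<^esup>)" using fillable_splits_subset by fast
  then have "finite {M. fillable (splits V s t) M}" using fin2 finite_subset by blast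
  then obtain M' where M': "fillable (splits V s t) M'" "M \<subseteq> M'"
    "\<And>M''. fillable (splits V s t) M'' \<Longrightarrow> M' \<subseteq> M'' \<Longrightarrow> M'' = M'"
    using finite_has_maximal2[of "{M. fillable (splits V s t) M}" M] assms(1) by auto
  have sub: "M' \<subseteq> [V]\<^bsup>2\<^esup>" using fillable_splits_subset[OF M'(1)] .
  then have fin: "finite M'" using fin2 finite_subset by auto
  have "card M \<le> card M'" using card_mono[OF fin M'(2)] .
  moreover have "card ([V]\<^bsup>2\<^esup> - M') + card M' = card V choose 2"
    using sub fin fin2 card_mono[OF fin2 sub] by (simp add: card_Diff_subset card_nsets)
  ultimately show ?thesis
    using maximal_fillable_imp_weakly_saturated[OF M'(1,3) assms(2-4)] by (intro exI[of _ "[V]\<^bsup>2\<^esup> - M'"]) auto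
qed

section \<open>The weak saturation number and sizes of fillable sets\<close>

lemma wsat_le:
  assumes "fillable (splits {..<n} s t) M" "0 < s" "0 < t"
  shows "wsat n (complete_bipartite s t) + card M \<le> n choose 2"
proof -
  obtain E where E: "E \<subseteq> [{..<n}]\<^bsup>2\<^esup>" "weakly_saturated (complete_bipartite s t) ({..<n}, E)"
    "card E + card M \<le> n choose 2"
    using exists_weakly_saturated[OF assms(1) _ assms(2,3)] by auto
  have "wsat n (complete_bipartite s t) \<le> card E" unfolding wsat_def
    by (rule Least_le, rule exI[of _ "({..<n}, E)"]) (use E in \<open>auto simp: finite_simple_graph_def\<close>)
  then show ?thesis using E(3) by simp
qed

lemma wsat_attained:
  assumes "0 < s" "0 < t"
  obtains V :: "nat set" and M where "finite V" "card V = n" "fillable (splits V s t) M"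
    "wsat n (complete_bipartite s t) + card M = n choose 2"
proof -
  let ?Q = "\<lambda>m. \<exists>G :: nat graph. finite_simple_graph G \<and> card (verts G) = n \<and>
                 weakly_saturated (complete_bipartite s t) G \<and> card (edges G) = m"
  \<comment> \<open>Starting from the empty fillable set shows that \<open>LEAST\<close> ranges over
    a nonempty set of values.\<close>
  obtain E where "E \<subseteq> [{..<n}]\<^bsup>2\<^esup>" "weakly_saturated (complete_bipartite s t) ({..<n}, E)"
    using exists_weakly_saturated[OF fillable_empty _ assms, of "{..<n}"] by auto
  then have "?Q (card E)" by (intro exI[of _ "({..<n}, E)"]) (auto simp: finite_simple_graph_def)
  then have "?Q (wsat n (complete_bipartite s t))" unfolding wsat_def by (rule LeastI)
  then obtain G :: "nat graph" where G: "finite_simple_graph G" "card (verts G) = n"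
    "weakly_saturated (complete_bipartite s t) G" "card (edges G) = wsat n (complete_bipartite s t)"
    by blast
  have sub: "edges G \<subseteq> [verts G]\<^bsup>2\<^esup>" and fin: "finite (verts G)"
    using G(1) by (auto simp: finite_simple_graph_def)
  have fin2: "finite ([verts G]\<^bsup>2\<^esup>)" using fin by (simp add: finite_imp_finite_nsets)
  have "card (edges G) + card ([verts G]\<^bsup>2\<^esup> - edges G) = n choose 2"
    using sub fin2 card_mono[OF fin2 sub] G(2) finite_subset[OF sub fin2]
    by (simp add: card_Diff_subset card_nsets)
  then show ?thesis using that[OF fin G(2) weakly_saturated_imp_fillable[OF G(3)]] G(4) by simp
qed

theorem theorem2:
  fixes s t :: nat
  assumes "s > 2" and "t > s"
  shows "(gcd s t = 1 \<longrightarrow>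
            int (wsat (s + t + 1) (complete_bipartite s t)) =
              int ((s + t + 1) choose 2) - (2 * int s + 2 * int t - 2)) \<and>
         (gcd s t > 1 \<longrightarrow>
            2 * int s + 2 * int t - 3 \<le>
              int ((s + t + 1) choose 2) - int (wsat (s + t + 1) (complete_bipartite s t)) \<and>
            int ((s + t + 1) choose 2) - int (wsat (s + t + 1) (complete_bipartite s t)) \<le>
              2 * int s + 2 * int t - 2)"
proof -
  let ?n = "s + t + 1" and ?w = "wsat (s + t + 1) (complete_bipartite s t)"
  have pos: "0 < s" "0 < t" using assms by auto
  obtain V :: "nat set" and M where V: "finite V" "card V = ?n" "fillable (splits V s t) M"
    "?w + card M = ?n choose 2"
    by (rule wsat_attained[OF pos])
  \<comment> \<open>Here \<open>2 * card V - 4\<close> is \<open>2 * s + 2 * t - 2\<close>.\<close>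
  have upper: "?n choose 2 \<le> ?w + (2 * s + 2 * t - 2)"
    using card_fillable_le[OF V(3,1,2) assms] V(2,4) by linarith
  have lower1: "?w + (2 * s + 2 * t - 2) \<le> ?n choose 2" if "gcd s t = 1"
  proof -
    have "coprime s (t - s)"
      using that gcd_diff1_nat[of s t] assms by (simp add: coprime_iff_gcd_eq_1 gcd.commute)
    then obtain N :: "nat set set" where "fillable (splits {..<?n} s t) N" "card N = 2 * s + 2 * t - 3 + 1"
      using exists_fillable[of s "t - s" t 0 "{..<?n}"] assms by auto
    then show ?thesis using wsat_le[OF _ pos, of ?n N] assms by simp
  qed
  have lower2: "?w + (2 * s + 2 * t - 3) \<le> ?n choose 2"
  proof -
    \<comment> \<open>The choice \<open>r = 1\<close> is coprime to every \<open>s\<close>. If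
      \<open>t = s + 1\<close>, then \<open>k = 0\<close> and the set has one edge more, hence the
      inequality.\<close>
    obtain N :: "nat set set" where "fillable (splits {..<?n} s t) N" "card N \<ge> 2 * s + 2 * t - 3"
      using exists_fillable[of s 1 t "t - s - 1" "{..<?n}"] assms by auto
    then show ?thesis using wsat_le[OF _ pos, of ?n N] by simp
  qed
  have "int (?n choose 2) \<le> int ?w + (2 * int s + 2 * int t - 2)" using upper assms by linarith
  moreover have "int ?w + (2 * int s + 2 * int t - 2) \<le> int (?n choose 2)" if "gcd s t = 1"
    using lower1[OF that] assms by linarith
  moreover have "int ?w + (2 * int s + 2 * int t - 3) \<le> int (?n choose 2)" using lower2 assms by linarith
  ultimately show ?thesis by (intro conjI impI; linarith)
qed

end
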